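(* For any density operator $\rho$ on a finite-dimensional bipartite system $AB$, the regularized and asymptotic quasiprobability extents with respect to the separable states satisfy $$\log_2\overline\gamma_{\mathrm{SEP}}(\rho)=E^{\mathrm{exact}}_{C,\mathrm{SEPP}}(\rho)\qquad\text{and}\qquad \log_2\gamma^\infty_{\mathrm{SEP}}(\rho)=E_{C,\mathrm{SEPP}}(\rho).$$
   Context: $\mathrm{SEP}(A;B)$ is the set of separable states, i.e. finite convex combinations of product states $\rho_A\otimes\sigma_B$. For a Hermitian operator $\omega$ on $AB$, $\gamma_{\mathrm{SEP}}(\omega)=\inf\{\sum_{i=1}^m|a_i| : m\ge1,\ \omega=\sum_{i=1}^m a_i\tau_i,\ \tau_i\in\mathrm{SEP}(A;B),\ a_i\in\mathbb{R}\}$. For a density operator $\rho$ and $\epsilon\ge0$, $\gamma^\epsilon_{\mathrm{SEP}}(\rho)=\min\{\gamma_{\mathrm{SEP}}(\sigma):\sigma\text{ a density operator on }AB,\ \tfrac12\|\rho-\sigma\|_1\le\epsilon\}$. Regularized extent: $\overline\gamma_{\mathrm{SEP}}(\rho)=\lim_{n\to\infty}\gamma_{\mathrm{SEP}}(\rho^{\otimes n})^{1/n}$. Asymptotic extent: $\gamma^\infty_{\mathrm{SEP}}(\rho)=\lim_{\epsilon\to0^+}\liminf_{n\to\infty}\gamma^\epsilon_{\mathrm{SEP}}(\rho^{\otimes n})^{1/n}$. Here $\rho^{\otimes n}$ is bipartite between $A^{\otimes n}$ and $B^{\otimes n}$. SEPP (separability preserving) channels: CPTP maps $\mathcal E$ from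 a bipartite system $CD$ to a bipartite system $C'D'$ with $\mathcal{E}(\mathrm{SEP}(C;D))\subset\mathrm{SEP}(C';D')$. Let $|\Psi_m\rangle$ denote the maximally entangled state with local dimension $m$. Single-shot entanglement cost: $E^{(1),\epsilon}_{C,\mathrm{SEPP}}(\rho)=\min_{m\in\mathbb{N}}\{\log_2 m : \exists\,\mathcal{E}\in\mathrm{SEPP},\ \tfrac12\|\rho-\mathcal{E}(|\Psi_m\rangle\langle\Psi_m|)\|_1\le\epsilon\}$. Asymptotic cost: $E_{C,\mathrm{SEPP}}(\rho)=\lim_{\epsilon\to0^+}\liminf_{n\to\infty}\frac1nE^{(1),\epsilon}_{C,\mathrm{SEPP}}(\rho^{\otimes n})$. Exact asymptotic cost: $E^{\mathrm{exact}}_{C,\mathrm{SEPP}}(\rho)=\lim_{n\to\infty}\frac1nE^{(1),0}_{C,\mathrm{SEPP}}(\rho^{\otimes n})$. *)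

theory Defs
  imports
    "Jordan_Normal_Form.Spectral_Radius"
    "Jordan_Normal_Form.Schur_Decomposition"
    "HOL-Library.Extended_Real"
    "HOL-Library.Liminf_Limsup"
begin

text \<open>
  Operators on an \<open>n\<close>-dimensional Hilbert space are complex \<open>n \<times> n\<close> matrices. The basis vector
  \<open>|a\<rangle> \<otimes> |b\<rangle>\<close> of a bipartite system with local dimensions \<open>dA\<close>, \<open>dB\<close> has index \<open>a * dB + b\<close>.
\<close>

section \<open>States, channels and the trace norm\<close>

definition mat_trace :: "complex mat \<Rightarrow> complex" where
  "mat_trace X = (\<Sum>i<dim_row X. X $$ (i, i))"

definition psd :: "nat \<Rightarrow> complex mat \<Rightarrow> bool" where
  "psd n X \<longleftrightarrow> X \<in> carrier_mat n n \<and> mat_adjoint X = X \<and>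
     (\<forall>v \<in> carrier_vec n. 0 \<le> Re ((X *\<^sub>v v) \<bullet>c v))"

definition density_op :: "nat \<Rightarrow> complex mat \<Rightarrow> bool" where
  "density_op n \<rho> \<longleftrightarrow> psd n \<rho> \<and> mat_trace \<rho> = 1"

text \<open>The sum of the singular values, i.e. of the square roots of the eigenvalues of \<open>X\<^sup>\<dagger> X\<close>, each
  counted with its algebraic multiplicity.\<close>

definition trace_norm :: "complex mat \<Rightarrow> real" where
  "trace_norm X = (let H = mat_adjoint X * X in
     \<Sum>z \<in> spectrum H. real (Polynomial.order z (char_poly H)) * sqrt (Re z))"

definition real_lincomb :: "nat \<Rightarrow> nat \<Rightarrow> (nat \<Rightarrow> real) \<Rightarrow> (nat \<Rightarrow> complex mat) \<Rightarrow> complex mat" where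
  "real_lincomb n m a T = mat n n (\<lambda>ij. \<Sum>k<m. complex_of_real (a k) * T k $$ ij)"

definition kron :: "complex mat \<Rightarrow> complex mat \<Rightarrow> complex mat" where
  "kron X Y = mat (dim_row X * dim_row Y) (dim_col X * dim_col Y)
     (\<lambda>(i, j). X $$ (i div dim_row Y, j div dim_col Y) * Y $$ (i mod dim_row Y, j mod dim_col Y))"

definition SEP :: "nat \<Rightarrow> nat \<Rightarrow> complex mat set" where
  "SEP dA dB = {real_lincomb (dA * dB) m p (\<lambda>k. kron (\<rho> k) (\<sigma> k)) | m p \<rho> \<sigma>.
     (\<forall>k<m. 0 \<le> p k \<and> density_op dA (\<rho> k) \<and> density_op dB (\<sigma> k)) \<and> (\<Sum>k<m. p k) = 1}"

text \<open>\<open>id\<^sub>k \<otimes> E\<close> for \<open>E\<close> from \<open>d\<close>-dimensional to \<open>d'\<close>-dimensional systems: \<open>E\<close> is applied to each of the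
  \<open>k \<times> k\<close> blocks of size \<open>d \<times> d\<close>.\<close>

definition ampliation ::
    "nat \<Rightarrow> nat \<Rightarrow> nat \<Rightarrow> (complex mat \<Rightarrow> complex mat) \<Rightarrow> complex mat \<Rightarrow> complex mat" where
  "ampliation k d d' E X = mat (k * d') (k * d') (\<lambda>(r, s).
     E (mat d d (\<lambda>(i, j). X $$ ((r div d') * d + i, (s div d') * d + j))) $$ (r mod d', s mod d'))"

definition cptp :: "nat \<Rightarrow> nat \<Rightarrow> (complex mat \<Rightarrow> complex mat) \<Rightarrow> bool" where
  "cptp d d' E \<longleftrightarrow>
     (\<forall>X \<in> carrier_mat d d. E X \<in> carrier_mat d' d') \<and>
     (\<forall>X \<in> carrier_mat d d. \<forall>Y \<in> carrier_mat d d. E (X + Y) = E X + E Y) \<and>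
     (\<forall>c. \<forall>X \<in> carrier_mat d d. E (c \<cdot>\<^sub>m X) = c \<cdot>\<^sub>m E X) \<and>
     (\<forall>k X. psd (k * d) X \<longrightarrow> psd (k * d') (ampliation k d d' E X)) \<and>
     (\<forall>X \<in> carrier_mat d d. mat_trace (E X) = mat_trace X)"

definition SEPP :: "nat \<Rightarrow> nat \<Rightarrow> nat \<Rightarrow> nat \<Rightarrow> (complex mat \<Rightarrow> complex mat) set" where
  "SEPP dC dD dC' dD' = {E. cptp (dC * dD) (dC' * dD') E \<and> E ` SEP dC dD \<subseteq> SEP dC' dD'}"

definition max_ent_vec :: "nat \<Rightarrow> complex vec" where
  "max_ent_vec m = vec (m * m) (\<lambda>r. if r div m = r mod m then complex_of_real (1 / sqrt (real m)) else 0)"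

definition max_ent_state :: "nat \<Rightarrow> complex mat" where
  "max_ent_state m = mat (m * m) (m * m) (\<lambda>(r, s). max_ent_vec m $ r * cnj (max_ent_vec m $ s))"

section \<open>Tensor powers of bipartite operators\<close>

text \<open>For \<open>X\<close> on \<open>AB\<close> and \<open>Y\<close> on \<open>A'B'\<close>, the operator \<open>X \<otimes> Y\<close> regarded as bipartite between
  \<open>AA'\<close> and \<open>BB'\<close>: the basis order is \<open>A, A', B, B'\<close>.\<close>

definition bip_tensor ::
    "nat \<Rightarrow> nat \<Rightarrow> nat \<Rightarrow> nat \<Rightarrow> complex mat \<Rightarrow> complex mat \<Rightarrow> complex mat" where
  "bip_tensor dA dB dA' dB' X Y =
     (let iA = (\<lambda>r. r div (dB * dB')); iB = (\<lambda>r. r mod (dB * dB'));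
          u = (\<lambda>r. (iA r div dA') * dB + iB r div dB');
          v = (\<lambda>r. (iA r mod dA') * dB' + iB r mod dB')
      in mat ((dA * dA') * (dB * dB')) ((dA * dA') * (dB * dB'))
           (\<lambda>(r, s). X $$ (u r, u s) * Y $$ (v r, v s)))"

fun bip_power :: "nat \<Rightarrow> nat \<Rightarrow> complex mat \<Rightarrow> nat \<Rightarrow> complex mat" where
  "bip_power dA dB \<rho> 0 = 1\<^sub>m 1"
| "bip_power dA dB \<rho> (Suc n) = bip_tensor dA dB (dA ^ n) (dB ^ n) \<rho> (bip_power dA dB \<rho> n)"

section \<open>Quasiprobability extents\<close>

definition gamma_SEP :: "nat \<Rightarrow> nat \<Rightarrow> complex mat \<Rightarrow> real" where
  "gamma_SEP dA dB \<omega> = Inf {\<Sum>i<m. \<bar>a i\<bar> | (m :: nat) a T.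
     m \<ge> 1 \<and> (\<forall>i<m. T i \<in> SEP dA dB) \<and> \<omega> = real_lincomb (dA * dB) m a T}"

definition gamma_SEP_eps :: "nat \<Rightarrow> nat \<Rightarrow> real \<Rightarrow> complex mat \<Rightarrow> real" where
  "gamma_SEP_eps dA dB \<epsilon> \<rho> = Inf {gamma_SEP dA dB \<sigma> | \<sigma>.
     density_op (dA * dB) \<sigma> \<and> trace_norm (\<rho> - \<sigma>) / 2 \<le> \<epsilon>}"

definition gamma_root :: "nat \<Rightarrow> nat \<Rightarrow> complex mat \<Rightarrow> nat \<Rightarrow> real" where
  "gamma_root dA dB \<rho> n = root n (gamma_SEP (dA ^ n) (dB ^ n) (bip_power dA dB \<rho> n))"

definition gamma_reg :: "nat \<Rightarrow> nat \<Rightarrow> complex mat \<Rightarrow> real" where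
  "gamma_reg dA dB \<rho> = lim (gamma_root dA dB \<rho>)"

text \<open>The limits inferior are taken in the extended reals because \<open>real\<close> is not a complete lattice.\<close>

definition gamma_liminf :: "nat \<Rightarrow> nat \<Rightarrow> complex mat \<Rightarrow> real \<Rightarrow> ereal" where
  "gamma_liminf dA dB \<rho> \<epsilon> =
     liminf (\<lambda>n. ereal (root n (gamma_SEP_eps (dA ^ n) (dB ^ n) \<epsilon> (bip_power dA dB \<rho> n))))"

definition gamma_asymp :: "nat \<Rightarrow> nat \<Rightarrow> complex mat \<Rightarrow> real" where
  "gamma_asymp dA dB \<rho> = real_of_ereal (Lim (at_right 0) (gamma_liminf dA dB \<rho>))"

section \<open>Entanglement cost under separability-preserving channels\<close>

text \<open>The infimum below is over a subset of \<open>{log 2 m | m \<ge> 1}\<close>, so it is attained whenever the set is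
  nonempty.\<close>

definition cost_one_shot :: "nat \<Rightarrow> nat \<Rightarrow> real \<Rightarrow> complex mat \<Rightarrow> real" where
  "cost_one_shot dA dB \<epsilon> \<rho> = Inf {log 2 (real m) | m :: nat. m \<ge> 1 \<and>
     (\<exists>E \<in> SEPP m m dA dB. trace_norm (\<rho> - E (max_ent_state m)) / 2 \<le> \<epsilon>)}"

definition cost_rate :: "nat \<Rightarrow> nat \<Rightarrow> complex mat \<Rightarrow> real \<Rightarrow> nat \<Rightarrow> real" where
  "cost_rate dA dB \<rho> \<epsilon> n = 1 / real n * cost_one_shot (dA ^ n) (dB ^ n) \<epsilon> (bip_power dA dB \<rho> n)"

definition cost_exact :: "nat \<Rightarrow> nat \<Rightarrow> complex mat \<Rightarrow> real" where
  "cost_exact dA dB \<rho> = lim (cost_rate dA dB \<rho> 0)"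

definition cost_liminf :: "nat \<Rightarrow> nat \<Rightarrow> complex mat \<Rightarrow> real \<Rightarrow> ereal" where
  "cost_liminf dA dB \<rho> \<epsilon> = liminf (\<lambda>n. ereal (cost_rate dA dB \<rho> \<epsilon> n))"

definition cost_asymp :: "nat \<Rightarrow> nat \<Rightarrow> complex mat \<Rightarrow> real" where
  "cost_asymp dA dB \<rho> = real_of_ereal (Lim (at_right 0) (cost_liminf dA dB \<rho>))"

end

theory Submission
  imports Defs "HOL-Analysis.L2_Norm"
begin

text \<open>
  Both equalities come from one-shot bounds: for every bipartite density operator and every
  \<open>\<epsilon> \<ge> 0\<close> the cost differs from \<open>log\<^sub>2 \<gamma>\<^sup>\<epsilon>\<close> by at most 4, and this disappears after division by
  \<open>n\<close>. Given \<open>\<sigma> = P - Q\<close> with \<open>P\<close>, \<open>Q\<close> in the cone generated by the product states, test the input for the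
  maximally entangled state \<open>\<Psi>\<^sub>m\<close>, prepare \<open>\<sigma>\<close> on success and the normalisation of \<open>Q\<close> on failure;
  a separable state passes with probability at most \<open>1/m\<close>, so for \<open>m \<ge> tr P + tr Q\<close> the output is
  separable. Conversely, separability-preserving channels do not increase \<open>\<gamma>\<close>, and polarising the matrix
  units gives \<open>\<gamma>(\<Psi>\<^sub>m) \<le> 16 m\<close>. The regularised limit exists because \<open>\<gamma>\<close> is submultiplicative (Fekete), and
  the limits \<open>\<epsilon> \<rightarrow> 0\<close> exist by monotonicity.
\<close>

section \<open>Gram kernels and positive semidefinite matrices\<close>

text \<open>The one-shot comparison works with every feasible value tr P + tr Q and takes infima
  only afterwards, so attainment is never an issue. Both one-shot quantities range over the same
  trace-norm ball. At radius 0 this ball is a single point, and the exact cost becomes the case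
  \<epsilon> = 0 of the same bounds. The constant 4 is \<open>log 2 16\<close>: in the polarisation
  the 16 pairs of phases cancel the normalisation 1/16, and a product of two traces, each at most 4,
  remains. In the other direction, rounding a feasible value up to an integer costs one bit.
  Positivity is handled through Gram vectors because regrouped tensor products, blocks of an
  ampliation, and a test together with its complement all act on such vectors explicitly.
  \<open>Inf\<close>, \<open>lim\<close> and \<open>Lim\<close> are total, so nonemptiness, bounds
  and convergence must be established before the defined quantities mean what they should; for this
  reason the theorem asserts the convergences as well.\<close>

lemma sum_divmod:
  fixes f :: "nat \<Rightarrow> 'a :: comm_monoid_add"
  shows "(\<Sum>r<a * b. f r) = (\<Sum>i<a. \<Sum>j<b. f (i * b + j))"
proof -
  have "(\<Sum>r<a * b. f r) = (\<Sum>i<a. \<Sum>r\<in>{i * b..<i * b + b}. f r)"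
    by (rule sum.nat_group [symmetric])
  also have "\<dots> = (\<Sum>i<a. \<Sum>j<b. f (i * b + j))"
    using sum.shift_bounds_nat_ivl[of f 0 _ b] by (simp add: atLeast0LessThan add.commute[of b] add.commute[of _ "_ * b"])
  finally show ?thesis .
qed

lemma div_less_mult:
  fixes i a b :: nat
  assumes "i < a * b" shows "i div b < a" "i mod b < b"
  using assms by (auto simp: less_mult_imp_div_less) (metis mod_less_divisor mult_0_right not_less_zero neq0_conv)

lemma index_less_mult:
  fixes i j a b :: nat
  assumes "i < a" "j < b" shows "i * b + j < a * b"
proof -
  have "i * b + j < Suc i * b" using assms by simp
  also have "\<dots> \<le> a * b" using assms by (intro mult_right_mono) auto
  finally show ?thesis .
qed

text \<open>Positivity is witnessed by vectors rather than by a quadratic form, so that closure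
  properties become explicit constructions. Kernels are functions on naturals, which turns
  reindexing by \<open>div\<close> and \<open>mod\<close> into composition; entries outside
  \<open>n\<close> are unconstrained.\<close>

definition gram :: "nat \<Rightarrow> (nat \<Rightarrow> nat \<Rightarrow> complex) \<Rightarrow> bool" where
  "gram n f \<longleftrightarrow> (\<exists>m w. \<forall>i<n. \<forall>j<n. f i j = (\<Sum>l<(m::nat). w l i * cnj (w l j)))"

text \<open>Witnesses may be indexed by any finite set, so disjoint sums and products of index sets
  can be used as they are.\<close>

lemma gramI:
  assumes "finite I" and "\<And>i j. i < n \<Longrightarrow> j < n \<Longrightarrow> f i j = (\<Sum>l\<in>I. w l i * cnj (w l j))"
  shows "gram n f"
proof -
  obtain h where h: "bij_betw h {0..<card I} I" using ex_bij_betw_nat_finite[OF assms(1)] by blast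
  have "(\<Sum>l\<in>I. w l i * cnj (w l j)) = (\<Sum>l<card I. w (h l) i * cnj (w (h l) j))" for i j
    using sum.reindex_bij_betw[OF h, of "\<lambda>l. w l i * cnj (w l j)"] by (simp add: atLeast0LessThan)
  then show ?thesis unfolding gram_def using assms(2) by (intro exI[of _ "card I"] exI[of _ "\<lambda>l. w (h l)"]) auto
qed

lemma gramE:
  assumes "gram n f"
  obtains m w where "\<And>i j. i < n \<Longrightarrow> j < n \<Longrightarrow> f i j = (\<Sum>l<(m::nat). w l i * cnj (w l j))"
  using assms unfolding gram_def by blast

lemma gram_cong:
  assumes "gram n f" "\<And>i j. i < n \<Longrightarrow> j < n \<Longrightarrow> f i j = g i j"
  shows "gram n g"
  using assms unfolding gram_def by auto

text \<open>Together with \<open>gram_mult\<close> this covers every tensor product below: an entry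
  of \<open>kron\<close> or \<open>bip_tensor\<close> is a product of two kernels, each pulled back
  along an index map.\<close>

lemma gram_pull:
  assumes "gram m f" "\<And>i. i < n \<Longrightarrow> u i < m"
  shows "gram n (\<lambda>i j. f (u i) (u j))"
proof -
  obtain k w where "\<And>i j. i < m \<Longrightarrow> j < m \<Longrightarrow> f i j = (\<Sum>l<(k::nat). w l i * cnj (w l j))"
    using assms(1) by (rule gramE) blast
  then show ?thesis using assms(2) by (intro gramI[of "{..<k}" n _ "\<lambda>l i. w l (u i)"]) auto
qed

lemma gram_add:
  assumes "gram n f" "gram n g"
  shows "gram n (\<lambda>i j. f i j + g i j)"
proof -
  obtain k w where w: "\<And>i j. i < n \<Longrightarrow> j < n \<Longrightarrow> f i j = (\<Sum>l<(k::nat). w l i * cnj (w l j))"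
    using assms(1) by (rule gramE) blast
  obtain k' w' where w': "\<And>i j. i < n \<Longrightarrow> j < n \<Longrightarrow> g i j = (\<Sum>l<(k'::nat). w' l i * cnj (w' l j))"
    using assms(2) by (rule gramE) blast
  show ?thesis
    by (rule gramI[of "{..<k} <+> {..<k'}" n _ "case_sum w w'"]) (auto simp: sum.Plus w w')
qed

text \<open>Schur product theorem: the entrywise products of the two families of Gram vectors
  witness the product.\<close>

lemma gram_mult:
  assumes "gram n f" "gram n g"
  shows "gram n (\<lambda>i j. f i j * g i j)"
proof -
  obtain k w where w: "\<And>i j. i < n \<Longrightarrow> j < n \<Longrightarrow> f i j = (\<Sum>l<(k::nat). w l i * cnj (w l j))"
    using assms(1) by (rule gramE) blast
  obtain k' w' where w': "\<And>i j. i < n \<Longrightarrow> j < n \<Longrightarrow> g i j = (\<Sum>l<(k'::nat). w' l i * cnj (w' l j))"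
    using assms(2) by (rule gramE) blast
  show ?thesis
    by (rule gramI[of "{..<k} \<times> {..<k'}" n _ "\<lambda>(l, l') i. w l i * w' l' i"])
       (auto simp: w w' sum_product sum.cartesian_product mult.assoc mult.left_commute intro!: sum.cong)
qed

lemma gram_scale:
  assumes "gram n f" "0 \<le> r"
  shows "gram n (\<lambda>i j. complex_of_real r * f i j)"
proof (rule gram_mult[OF _ assms(1)])
  show "gram n (\<lambda>i j. complex_of_real r)"
    using assms(2)
    by (intro gramI[of "{0::nat}" n _ "\<lambda>_ _. complex_of_real (sqrt r)"])
       (auto simp flip: of_real_mult)
qed

text \<open>Cholesky factorisation: the last row and column are split off by a Schur complement.\<close>

lemma gram_of_quadratic_form:
  assumes "\<forall>i<n. \<forall>j<n. f j i = cnj (f i j)"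
    and "\<forall>v :: nat \<Rightarrow> complex. 0 \<le> Re (\<Sum>i<n. \<Sum>j<n. f i j * v j * cnj (v i))"
  shows "gram n f"
  using assms
proof (induction n arbitrary: f)
  case 0
  then show ?case by (auto simp: gram_def)
next
  case (Suc n)
  define d where "d = Re (f n n)"
  have fnn: "f n n = complex_of_real d"
    using Suc.prems(1) by (metis d_def Reals_cnj_iff lessI complex_is_Real_iff of_real_Re)
  have herm: "f n i = cnj (f i n)" "f i n = cnj (f n i)" if "i < n" for i
    using Suc.prems(1) that by (metis lessI less_Suc_eq)+
  define S where "S v = (\<Sum>j<n. f n j * v j)" for v :: "nat \<Rightarrow> complex"
  define Q where "Q v = (\<Sum>i<n. \<Sum>j<n. f i j * v j * cnj (v i))" for v :: "nat \<Rightarrow> complex"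
  have cS: "(\<Sum>i<n. f i n * cnj (v i)) = cnj (S v)" for v
    unfolding S_def by (simp add: herm(1))
  \<comment> \<open>The form at \<open>v\<close> with last coordinate \<open>t\<close>, split by
    powers of \<open>t\<close>. Both cases below only choose \<open>t\<close>.\<close>
  have key: "0 \<le> Re (Q v + t * cnj (S v) + S v * cnj t + d * (t * cnj t))" for v t
  proof -
    define v' where "v' = v(n := t)"
    have "(\<Sum>i<Suc n. \<Sum>j<Suc n. f i j * v' j * cnj (v' i))
        = Q v + t * (\<Sum>i<n. f i n * cnj (v i)) + S v * cnj t + d * (t * cnj t)"
      by (simp add: v'_def Q_def S_def sum.distrib sum_distrib_left sum_distrib_right fnn mult_ac)
    moreover have "0 \<le> Re (\<Sum>i<Suc n. \<Sum>j<Suc n. f i j * v' j * cnj (v' i))"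
      using Suc.prems(2) by blast
    ultimately show ?thesis by (simp add: cS)
  qed
  have d0: "0 \<le> d" using key[of "\<lambda>_. 0" 1] by (simp add: Q_def S_def)
  show ?case
  proof (cases "d = 0")
    case True
    \<comment> \<open>A vanishing corner leaves the form affine in \<open>t\<close>, hence unbounded
      below unless the last row vanishes; \<open>k\<close> makes the linear term exceed
      \<open>Re (Q v)\<close>.\<close>
    have f0: "f n i = 0" if i: "i < n" for i
    proof (rule ccontr)
      assume ne: "f n i \<noteq> 0"
      define v :: "nat \<Rightarrow> complex" where "v = (\<lambda>j. if j = i then 1 else 0)"
      have Sv: "S v = f n i" using i by (simp add: S_def v_def if_distrib cong: if_cong)
      have nz: "(norm (f n i))\<^sup>2 = Re (f n i) * Re (f n i) + Im (f n i) * Im (f n i)"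
        unfolding cmod_power2 by (simp add: power2_eq_square)
      define k where "k = (\<bar>Re (Q v)\<bar> + 1) / (norm (f n i))\<^sup>2"
      have "0 \<le> Re (Q v + (- k * S v) * cnj (S v) + S v * cnj (- k * S v) + d * ((- k * S v) * cnj (- k * S v)))"
        by (rule key)
      also have "\<dots> = Re (Q v) - 2 * (k * (norm (f n i))\<^sup>2)"
        by (simp add: True Sv nz algebra_simps)
      also have "k * (norm (f n i))\<^sup>2 = \<bar>Re (Q v)\<bar> + 1" using ne by (simp add: k_def)
      finally have "0 \<le> Re (Q v) - 2 * (\<bar>Re (Q v)\<bar> + 1)" .
      then show False by (simp add: abs_if split: if_splits)
    qed
    have "gram n f"
    proof (rule Suc.IH)
      show "\<forall>i<n. \<forall>j<n. f j i = cnj (f i j)" using Suc.prems(1) less_SucI by blast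
      show "\<forall>v. 0 \<le> Re (\<Sum>i<n. \<Sum>j<n. f i j * v j * cnj (v i))"
        using key[of _ 0] by (simp add: Q_def)
    qed
    then obtain m w where w: "\<And>i j. i < n \<Longrightarrow> j < n \<Longrightarrow> f i j = (\<Sum>l<(m::nat). w l i * cnj (w l j))"
      by (rule gramE) blast
    show ?thesis
      by (rule gramI[of "{..<m}" _ _ "\<lambda>l i. if i < n then w l i else 0"])
         (auto simp: less_Suc_eq w f0 fnn True herm(2))
  next
    case False
    with d0 have d: "d > 0" by simp
    \<comment> \<open>Schur complement of the corner \<open>d\<close>; the rank-one remainder is
      Gram with the single vector \<open>f i n / sqrt d\<close>.\<close>
    define g where "g i j = f i j - f i n * f n j / d" for i j
    have "gram n g"
    proof (rule Suc.IH)
      show "\<forall>i<n. \<forall>j<n. g j i = cnj (g i j)"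
      proof (intro allI impI)
        fix i j assume ij: "i < n" "j < n"
        then have "f j i = cnj (f i j)" using Suc.prems(1) less_SucI by blast
        then show "g j i = cnj (g i j)"
          unfolding g_def by (simp add: herm(1)[OF ij(1)] herm(1)[OF ij(2)])
      qed
      show "\<forall>v. 0 \<le> Re (\<Sum>i<n. \<Sum>j<n. g i j * v j * cnj (v i))"
      proof
        fix v :: "nat \<Rightarrow> complex"
        have "(\<Sum>i<n. \<Sum>j<n. g i j * v j * cnj (v i))
            = Q v - (\<Sum>i<n. \<Sum>j<n. (f i n * cnj (v i)) * (f n j * v j)) / d"
          by (simp add: g_def Q_def sum_subtractf sum_divide_distrib algebra_simps)
        also have "(\<Sum>i<n. \<Sum>j<n. (f i n * cnj (v i)) * (f n j * v j)) = cnj (S v) * S v"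
          by (simp add: sum_product[symmetric] cS) (simp add: S_def)
        \<comment> \<open>The value \<open>t = - S v / d\<close> completes the square, so the form
          of \<open>g\<close> is a value of the form of \<open>f\<close>.\<close>
        also have "Q v - cnj (S v) * S v / d = Q v + (- S v / d) * cnj (S v) + S v * cnj (- S v / d)
            + d * ((- S v / d) * cnj (- S v / d))"
          using d by (simp add: field_simps)
        finally show "0 \<le> Re (\<Sum>i<n. \<Sum>j<n. g i j * v j * cnj (v i))"
          using key[of v "- S v / d"] by (simp only:)
      qed
    qed
    then obtain m w where w: "\<And>i j. i < n \<Longrightarrow> j < n \<Longrightarrow> g i j = (\<Sum>l<(m::nat). w l i * cnj (w l j))"
      by (rule gramE) blast
    have 1: "gram (Suc n) (\<lambda>i j. if i < n \<and> j < n then g i j else 0)"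
      by (rule gramI[of "{..<m}" _ _ "\<lambda>l i. if i < n then w l i else 0"]) (auto simp: w)
    have sq: "complex_of_real (sqrt d) * complex_of_real (sqrt d) = d"
      using d by (simp flip: of_real_mult)
    have 2: "gram (Suc n) (\<lambda>i j. f i n * f n j / d)"
    proof (rule gramI[of "{0::nat}" _ _ "\<lambda>_ i. f i n / sqrt d"])
      fix i j assume "i < Suc n" "j < Suc n"
      then have "f n j = cnj (f j n)" using Suc.prems(1) by blast
      then show "f i n * f n j / d = (\<Sum>l\<in>{0::nat}. f i n / sqrt d * cnj (f j n / sqrt d))"
        by (simp add: sq)
    qed simp
    show ?thesis
      by (rule gram_cong[OF gram_add[OF 1 2]]) (use d in \<open>auto simp: g_def less_Suc_eq fnn\<close>)
  qed
qed

section \<open>Adjoints, traces and eigenvalues of positive semidefinite matrices\<close>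

lemma mat_adjoint_dim [simp]:
  "dim_row (mat_adjoint X) = dim_col X" "dim_col (mat_adjoint X) = dim_row X"
  by (simp_all add: mat_adjoint_def)

lemma mat_adjoint_carrier [simp]: "X \<in> carrier_mat m n \<Longrightarrow> mat_adjoint X \<in> carrier_mat n m"
  by (auto simp: mat_adjoint_def)

lemma mat_adjoint_index:
  assumes "X \<in> carrier_mat m n" "i < n" "j < m"
  shows "mat_adjoint X $$ (i, j) = cnj (X $$ (j, i))"
  using assms by (auto simp: mat_adjoint_def mat_of_rows_index)

lemma quadratic_form_mat:
  fixes X :: "complex mat"
  assumes "X \<in> carrier_mat n n" "v \<in> carrier_vec n"
  shows "(X *\<^sub>v v) \<bullet>c v = (\<Sum>i<n. \<Sum>j<n. X $$ (i, j) * v $ j * cnj (v $ i))"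
  using assms by (auto simp: scalar_prod_def sum_distrib_right atLeast0LessThan intro!: sum.cong)

text \<open>Cholesky in one direction; in the other, the quadratic form is a sum of squared moduli,
  one for each Gram vector.\<close>

lemma psd_iff_gram: "psd n X \<longleftrightarrow> X \<in> carrier_mat n n \<and> gram n (\<lambda>i j. X $$ (i, j))"
proof
  assume p: "psd n X"
  then have X: "X \<in> carrier_mat n n" and adj: "mat_adjoint X = X"
    and pos: "\<And>v. v \<in> carrier_vec n \<Longrightarrow> 0 \<le> Re ((X *\<^sub>v v) \<bullet>c v)"
    by (auto simp: psd_def)
  have "gram n (\<lambda>i j. X $$ (i, j))"
  proof (rule gram_of_quadratic_form)
    show "\<forall>i<n. \<forall>j<n. X $$ (j, i) = cnj (X $$ (i, j))"
      using mat_adjoint_index[OF X] adj by metis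
    show "\<forall>v. 0 \<le> Re (\<Sum>i<n. \<Sum>j<n. X $$ (i, j) * v j * cnj (v i))"
    proof
      fix v :: "nat \<Rightarrow> complex"
      show "0 \<le> Re (\<Sum>i<n. \<Sum>j<n. X $$ (i, j) * v j * cnj (v i))"
        using pos[of "vec n v"] quadratic_form_mat[OF X, of "vec n v"] by simp
    qed
  qed
  with X show "X \<in> carrier_mat n n \<and> gram n (\<lambda>i j. X $$ (i, j))" by simp
next
  assume "X \<in> carrier_mat n n \<and> gram n (\<lambda>i j. X $$ (i, j))"
  then obtain m w where X: "X \<in> carrier_mat n n"
    and w: "\<And>i j. i < n \<Longrightarrow> j < n \<Longrightarrow> X $$ (i, j) = (\<Sum>l<(m::nat). w l i * cnj (w l j))"
    by (elim conjE gramE) blast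
  have "mat_adjoint X = X"
    using X by (intro eq_matI) (auto simp: mat_adjoint_index[OF X] w mult.commute)
  moreover have "0 \<le> Re ((X *\<^sub>v v) \<bullet>c v)" if v: "v \<in> carrier_vec n" for v
  proof -
    have "(X *\<^sub>v v) \<bullet>c v = (\<Sum>i<n. \<Sum>j<n. \<Sum>l<m. w l i * cnj (w l j) * v $ j * cnj (v $ i))"
      unfolding quadratic_form_mat[OF X v] by (simp add: w sum_distrib_right)
    also have "\<dots> = (\<Sum>i<n. \<Sum>l<m. \<Sum>j<n. w l i * cnj (w l j) * v $ j * cnj (v $ i))"
      by (rule sum.cong[OF refl], rule sum.swap)
    also have "\<dots> = (\<Sum>l<m. \<Sum>i<n. \<Sum>j<n. w l i * cnj (w l j) * v $ j * cnj (v $ i))"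
      by (rule sum.swap)
    also have "\<dots> = (\<Sum>l<m. (\<Sum>i<n. w l i * cnj (v $ i)) * cnj (\<Sum>i<n. w l i * cnj (v $ i)))"
      unfolding sum_product cnj_sum complex_cnj_mult complex_cnj_cnj
      by (intro sum.cong refl) (simp add: mult_ac)
    also have "Re \<dots> = (\<Sum>l<m. (norm (\<Sum>i<n. w l i * cnj (v $ i)))\<^sup>2)"
      unfolding complex_norm_square[symmetric] by simp
    also have "\<dots> \<ge> 0" by (simp add: sum_nonneg)
    finally show ?thesis .
  qed
  ultimately show "psd n X" using X by (auto simp: psd_def)
qed

lemma psd_carrier: "psd n X \<Longrightarrow> X \<in> carrier_mat n n"
  by (simp add: psd_def)

lemma psd_zero: "psd n (0\<^sub>m n n)"
  unfolding psd_iff_gram by (auto intro!: gramI[of "{}"])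

lemma psd_add: "psd n X \<Longrightarrow> psd n Y \<Longrightarrow> psd n (X + Y)"
  unfolding psd_iff_gram by (auto intro!: gram_cong[OF gram_add[of n "\<lambda>i j. X $$ (i, j)" "\<lambda>i j. Y $$ (i, j)"]])

lemma psd_scale: "psd n X \<Longrightarrow> 0 \<le> r \<Longrightarrow> psd n (complex_of_real r \<cdot>\<^sub>m X)"
  unfolding psd_iff_gram by (auto intro!: gram_cong[OF gram_scale[of n "\<lambda>i j. X $$ (i, j)" r]])

lemma mat_trace_carrier: "X \<in> carrier_mat n n \<Longrightarrow> mat_trace X = (\<Sum>i<n. X $$ (i, i))"
  by (auto simp: mat_trace_def)

lemma mat_trace_zero [simp]: "mat_trace (0\<^sub>m n n) = 0"
  by (simp add: mat_trace_def)

lemma mat_trace_add: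
  "X \<in> carrier_mat n n \<Longrightarrow> Y \<in> carrier_mat n n \<Longrightarrow> mat_trace (X + Y) = mat_trace X + mat_trace Y"
  by (simp add: mat_trace_carrier[of _ n] sum.distrib)

lemma mat_trace_smult: "X \<in> carrier_mat n n \<Longrightarrow> mat_trace (c \<cdot>\<^sub>m X) = c * mat_trace X"
  by (simp add: mat_trace_carrier[of _ n] sum_distrib_left)

lemma mat_trace_mult_comm:
  assumes "X \<in> carrier_mat m n" "Y \<in> carrier_mat n m"
  shows "mat_trace (X * Y) = mat_trace (Y * X)"
proof -
  have "mat_trace (X * Y) = (\<Sum>i<m. \<Sum>j<n. X $$ (i, j) * Y $$ (j, i))"
    using assms by (subst mat_trace_carrier[of _ m]) (auto simp: scalar_prod_def atLeast0LessThan)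
  also have "\<dots> = (\<Sum>j<n. \<Sum>i<m. Y $$ (j, i) * X $$ (i, j))"
    by (subst sum.swap) (simp add: mult.commute)
  also have "\<dots> = mat_trace (Y * X)"
    using assms by (subst mat_trace_carrier[of _ n]) (auto simp: scalar_prod_def atLeast0LessThan)
  finally show ?thesis .
qed

lemma mat_trace_similar:
  assumes "similar_mat A B" shows "mat_trace A = mat_trace B"
proof -
  obtain n P Q where c: "{A, B, P, Q} \<subseteq> carrier_mat n n" and "Q * P = 1\<^sub>m n" "A = P * B * Q"
    using similar_matD[OF assms] by blast
  then have "mat_trace A = mat_trace (P * (B * Q))" by (simp add: assoc_mult_mat[of _ n n _ n _ n])
  also have "\<dots> = mat_trace (B * Q * P)" using c by (intro mat_trace_mult_comm[of _ n n]) auto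
  also have "B * Q * P = B * (Q * P)" using c by (simp add: assoc_mult_mat[of _ n n _ n _ n])
  also have "\<dots> = B" unfolding \<open>Q * P = 1\<^sub>m n\<close> using c by (simp add: right_mult_one_mat[of B n n])
  finally show ?thesis .
qed

text \<open>The trace is the sum of the squared moduli of all Gram coordinates, so trace zero
  annihilates every Gram vector.\<close>

lemma psd_trace:
  assumes "psd n X"
  shows "mat_trace X = complex_of_real (Re (mat_trace X))" "0 \<le> Re (mat_trace X)"
    "Re (mat_trace X) = 0 \<Longrightarrow> X = 0\<^sub>m n n"
proof -
  obtain m w where X: "X \<in> carrier_mat n n"
    and w: "\<And>i j. i < n \<Longrightarrow> j < n \<Longrightarrow> X $$ (i, j) = (\<Sum>l<(m::nat). w l i * cnj (w l j))"
    using assms(1) unfolding psd_iff_gram by (elim conjE gramE) blast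
  have tr: "mat_trace X = complex_of_real (\<Sum>i<n. \<Sum>l<m. (norm (w l i))\<^sup>2)"
    unfolding mat_trace_carrier[OF X] by (simp add: w complex_norm_square[symmetric])
  show "mat_trace X = complex_of_real (Re (mat_trace X))" by (simp add: tr)
  show "0 \<le> Re (mat_trace X)" by (auto simp: tr intro!: sum_nonneg)
  assume "Re (mat_trace X) = 0"
  then have "(\<Sum>i<n. \<Sum>l<m. (norm (w l i))\<^sup>2) = 0" by (simp add: tr del: of_real_sum)
  then have "\<And>i l. i < n \<Longrightarrow> l < m \<Longrightarrow> w l i = 0"
    by (subst (asm) sum_nonneg_eq_0_iff) (auto simp: sum_nonneg sum_nonneg_eq_0_iff)
  then show "X = 0\<^sub>m n n" using X by (intro eq_matI) (auto simp: w)
qed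

lemma density_op_dim_pos: "density_op n \<rho> \<Longrightarrow> 0 < n"
  by (cases n) (auto simp: density_op_def psd_def mat_trace_carrier)

text \<open>\<open>trace_norm\<close> takes \<open>sqrt (Re z)\<close> over a spectrum; this makes
  its summands nonnegative and lets \<open>Re z = 0\<close> force \<open>z = 0\<close>.\<close>

lemma psd_eigenvalue:
  assumes "psd n H" "eigenvalue H z"
  shows "z = complex_of_real (Re z)" "0 \<le> Re z"
proof -
  obtain v where v: "v \<in> carrier_vec n" "v \<noteq> 0\<^sub>v n" "H *\<^sub>v v = z \<cdot>\<^sub>v v"
    using assms psd_carrier[OF assms(1)] by (auto simp: eigenvalue_def eigenvector_def)
  obtain m w where H: "H \<in> carrier_mat n n"
    and w: "\<And>i j. i < n \<Longrightarrow> j < n \<Longrightarrow> H $$ (i, j) = (\<Sum>l<(m::nat). w l i * cnj (w l j))"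
    using assms(1) unfolding psd_iff_gram by (elim conjE gramE) blast
  define N where "N = (\<Sum>i<n. (norm (v $ i))\<^sup>2)"
  have N: "v \<bullet>c v = complex_of_real N"
    using v(1) by (auto simp: scalar_prod_def N_def atLeast0LessThan complex_norm_square[symmetric])
  have "v \<bullet>c v \<noteq> 0" using v conjugate_square_eq_0_vec by blast
  then have Npos: "N > 0" using N by (metis N_def less_le of_real_0 sum_nonneg zero_le_power2)
  have eq: "(H *\<^sub>v v) \<bullet>c v = z * N" using v N by simp
  have "cnj ((H *\<^sub>v v) \<bullet>c v) = (\<Sum>i<n. \<Sum>j<n. H $$ (j, i) * cnj (v $ j) * v $ i)"
    unfolding quadratic_form_mat[OF H v(1)] by (simp add: w mult.commute)
  also have "\<dots> = (H *\<^sub>v v) \<bullet>c v"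
    unfolding quadratic_form_mat[OF H v(1)] by (subst sum.swap) (simp add: mult_ac)
  finally have "cnj z = z" using eq Npos by simp
  then show "z = complex_of_real (Re z)" by (metis Reals_cnj_iff of_real_Re)
  have "0 \<le> Re ((H *\<^sub>v v) \<bullet>c v)" using assms(1) v(1) by (simp add: psd_def)
  then show "0 \<le> Re z" using eq Npos by (simp add: zero_le_mult_iff)
qed

section \<open>Definiteness of the trace norm\<close>

lemma psd_adjoint_mult:
  assumes "X \<in> carrier_mat m n"
  shows "psd n (mat_adjoint X * X)"
proof -
  have "gram n (\<lambda>i j. (mat_adjoint X * X) $$ (i, j))"
    using assms mat_adjoint_carrier[OF assms]
    by (intro gramI[of "{..<m}" _ _ "\<lambda>l i. cnj (X $$ (l, i))"])
       (auto simp: scalar_prod_def mat_adjoint_index[OF assms] atLeast0LessThan)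
  then show ?thesis unfolding psd_iff_gram using assms mat_adjoint_carrier[OF assms] mult_carrier_mat by blast
qed

text \<open>A vanishing sum of singular values leaves 0 as the only eigenvalue of \<open>H\<close>.
  Schur triangularisation turns this into trace zero, and the trace of \<open>H\<close> is the sum
  of the squared moduli of the entries of \<open>X\<close>.\<close>

lemma trace_norm_nonpos_imp_zero:
  assumes X: "X \<in> carrier_mat n n" and "trace_norm X \<le> 0"
  shows "X = 0\<^sub>m n n"
proof -
  define H where "H = mat_adjoint X * X"
  have pH: "psd n H" using psd_adjoint_mult[OF X] by (simp add: H_def)
  then have H: "H \<in> carrier_mat n n" by (rule psd_carrier)
  \<comment> \<open>Eigenvalues are roots of a nonzero polynomial, so their multiplicities are
    positive and no summand is hidden by a zero weight.\<close>
  have "char_poly H \<noteq> 0" using degree_monic_char_poly[OF H] by auto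
  then have ord: "0 < real (Polynomial.order z (char_poly H))" if "z \<in> spectrum H" for z
    using that spectrum_root_char_poly[OF H] by (simp add: order_root)
  have nonneg: "0 \<le> Re z" if "z \<in> spectrum H" for z
    using that psd_eigenvalue(2)[OF pH] by (simp add: spectrum_def)
  have "(\<Sum>z\<in>spectrum H. real (Polynomial.order z (char_poly H)) * sqrt (Re z)) \<le> 0"
    using assms(2) by (simp add: trace_norm_def H_def Let_def)
  then have "(\<Sum>z\<in>spectrum H. real (Polynomial.order z (char_poly H)) * sqrt (Re z)) = 0"
    using nonneg by (intro antisym sum_nonneg) auto
  then have "Re z = 0" if "z \<in> spectrum H" for z
    using that ord[OF that] nonneg card_finite_spectrum(1)[OF H]
    by (subst (asm) sum_nonneg_eq_0_iff) auto
  then have ev0: "z = 0" if "eigenvalue H z" for z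
    using that psd_eigenvalue(1)[OF pH that] by (simp add: spectrum_def)
  obtain es where es: "char_poly H = (\<Prod>a\<leftarrow>es. [:- a, 1:])" using char_poly_factorized[OF H] by blast
  obtain B where B: "B \<in> carrier_mat n n" "upper_triangular B" "similar_mat H B"
    using schur_decomposition_exists[OF H es] by blast
  \<comment> \<open>The diagonal of a triangular form consists of roots of the characteristic
    polynomial, which similarity preserves.\<close>
  have "B $$ (i, i) = 0" if "i < n" for i
  proof -
    have "poly (char_poly B) (B $$ (i, i)) = 0"
      using that B(1) unfolding char_poly_upper_triangular[OF B(1,2)]
      by (auto simp: poly_prod_list prod_list_zero_iff diag_mat_def)
    then have "poly (char_poly H) (B $$ (i, i)) = 0" using char_poly_similar[OF B(3)] by simp
    then show ?thesis using ev0 eigenvalue_root_char_poly[OF H] by blast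
  qed
  then have "mat_trace H = 0" using mat_trace_similar[OF B(3)] mat_trace_carrier[OF B(1)] by simp
  moreover have "mat_trace H = complex_of_real (\<Sum>i<n. \<Sum>l<n. (norm (X $$ (l, i)))\<^sup>2)"
    unfolding H_def using X mat_adjoint_carrier[OF X]
    by (subst mat_trace_carrier[of _ n])
       (auto simp: scalar_prod_def mat_adjoint_index[OF X] atLeast0LessThan complex_norm_square[symmetric]
          mult.commute[of "cnj _"] intro!: sum.cong)
  ultimately have "(\<Sum>i<n. \<Sum>l<n. (norm (X $$ (l, i)))\<^sup>2) = 0" by (metis of_real_eq_0_iff)
  then have "\<And>i l. i < n \<Longrightarrow> l < n \<Longrightarrow> X $$ (l, i) = 0"
    by (subst (asm) sum_nonneg_eq_0_iff) (auto simp: sum_nonneg sum_nonneg_eq_0_iff)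
  then show ?thesis using X by (intro eq_matI) auto
qed

text \<open>Puts a state into its own ball, so that infima over balls are taken over nonempty
  sets.\<close>

lemma trace_norm_zero:
  assumes "0 < n" shows "trace_norm (0\<^sub>m n n) = 0"
proof -
  have adj: "mat_adjoint (0\<^sub>m n n) * 0\<^sub>m n n = (0\<^sub>m n n :: complex mat)"
    by (rule right_mult_zero_mat[of _ n n]) simp
  have z0: "z = 0" if z: "z \<in> spectrum (0\<^sub>m n n)" for z :: complex
  proof -
    obtain v where "eigenvector (0\<^sub>m n n) v z"
      using z by (auto simp: spectrum_def eigenvalue_def)
    then have v: "v \<in> carrier_vec n" "v \<noteq> 0\<^sub>v n" "0\<^sub>m n n *\<^sub>v v = z \<cdot>\<^sub>v v"
      by (simp_all add: eigenvector_def)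
    obtain i where i: "i < n" "v $ i \<noteq> 0" using v(1,2) by (metis eq_vecI carrier_vecD index_zero_vec)
    have "0\<^sub>m n n *\<^sub>v v = 0\<^sub>v n" using v(1) by (intro eq_vecI) auto
    then have "z \<cdot>\<^sub>v v = 0\<^sub>v n" using v(3) by simp
    then have "(z \<cdot>\<^sub>v v) $ i = 0" using i by simp
    then show ?thesis using v(1) i by simp
  qed
  then show ?thesis unfolding trace_norm_def Let_def adj
    by (intro sum.neutral ballI) (metis z0 mult_zero_right real_sqrt_zero zero_complex.sel(1))
qed

section \<open>The cone of separable operators\<close>

lemma kron_carrier:
  "X \<in> carrier_mat m n \<Longrightarrow> Y \<in> carrier_mat p q \<Longrightarrow> kron X Y \<in> carrier_mat (m * p) (n * q)"
  by (auto simp: kron_def)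

lemma kron_index:
  assumes "X \<in> carrier_mat m n" "Y \<in> carrier_mat p q" "i < m * p" "j < n * q"
  shows "kron X Y $$ (i, j) = X $$ (i div p, j div q) * Y $$ (i mod p, j mod q)"
  using assms by (auto simp: kron_def)

lemma psd_kron:
  assumes "psd m X" "psd n Y" shows "psd (m * n) (kron X Y)"
proof -
  have X: "X \<in> carrier_mat m m" "gram m (\<lambda>i j. X $$ (i, j))"
    and Y: "Y \<in> carrier_mat n n" "gram n (\<lambda>i j. Y $$ (i, j))"
    using assms by (auto simp: psd_iff_gram)
  have "gram (m * n) (\<lambda>i j. X $$ (i div n, j div n) * Y $$ (i mod n, j mod n))"
    by (intro gram_mult gram_pull[OF X(2)] gram_pull[OF Y(2)] div_less_mult)
  then have "gram (m * n) (\<lambda>i j. kron X Y $$ (i, j))"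
    by (rule gram_cong) (simp add: kron_index[OF X(1) Y(1)])
  then show ?thesis using kron_carrier[OF X(1) Y(1)] by (simp add: psd_iff_gram)
qed

lemma mat_trace_kron:
  assumes "X \<in> carrier_mat m m" "Y \<in> carrier_mat n n"
  shows "mat_trace (kron X Y) = mat_trace X * mat_trace Y"
proof -
  have "mat_trace (kron X Y) = (\<Sum>i<m. \<Sum>j<n. X $$ (i, i) * Y $$ (j, j))"
    unfolding mat_trace_carrier[OF kron_carrier[OF assms]] sum_divmod
    by (intro sum.cong refl) (simp add: kron_index[OF assms] index_less_mult)
  then show ?thesis using assms by (simp add: mat_trace_carrier[of _ m] mat_trace_carrier[of _ n] sum_product)
qed

lemma density_op_kron:
  "density_op m \<rho> \<Longrightarrow> density_op n \<sigma> \<Longrightarrow> density_op (m * n) (kron \<rho> \<sigma>)"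
  by (auto simp: density_op_def psd_kron mat_trace_kron[OF psd_carrier psd_carrier])

lemma kron_smult:
  assumes "X \<in> carrier_mat m m" "Y \<in> carrier_mat n n"
  shows "kron (c \<cdot>\<^sub>m X) (d \<cdot>\<^sub>m Y) = (c * d) \<cdot>\<^sub>m kron X Y"
  using assms
  by (intro eq_matI) (auto simp: kron_def div_less_mult)

text \<open>Unnormalised separable operators: without weights or division by traces, additive and
  multiplicative closure follow by rule induction. Scaling is no generator because a nonnegative
  factor can be absorbed into \<open>A\<close>.\<close>

inductive_set sep_cone :: "nat \<Rightarrow> nat \<Rightarrow> complex mat set" for a b where
  zero: "0\<^sub>m (a * b) (a * b) \<in> sep_cone a b"
| add: "X \<in> sep_cone a b \<Longrightarrow> Y \<in> sep_cone a b \<Longrightarrow> X + Y \<in> sep_cone a b"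
| kron: "psd a A \<Longrightarrow> psd b B \<Longrightarrow> kron A B \<in> sep_cone a b"

lemma sep_cone_psd: "X \<in> sep_cone a b \<Longrightarrow> psd (a * b) X"
  by (induction rule: sep_cone.induct) (auto simp: psd_zero psd_add psd_kron)

lemma sep_cone_carrier: "X \<in> sep_cone a b \<Longrightarrow> X \<in> carrier_mat (a * b) (a * b)"
  using sep_cone_psd psd_carrier by blast

lemma sep_cone_scale:
  assumes "X \<in> sep_cone a b" "0 \<le> r"
  shows "complex_of_real r \<cdot>\<^sub>m X \<in> sep_cone a b"
  using assms(1)
proof (induction rule: sep_cone.induct)
  case zero
  then show ?case by (simp add: sep_cone.zero)
next
  case (add X Y)
  then show ?case
    by (simp add: add_smult_distrib_left_mat[OF sep_cone_carrier sep_cone_carrier] sep_cone.add)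
next
  case (kron A B)
  have "complex_of_real r \<cdot>\<^sub>m kron A B = kron (complex_of_real r \<cdot>\<^sub>m A) (1 \<cdot>\<^sub>m B)"
    using kron_smult[OF psd_carrier psd_carrier, OF kron, of "complex_of_real r" 1] by simp
  also have "\<dots> \<in> sep_cone a b"
    using psd_scale[OF kron(1) assms(2)] psd_scale[OF kron(2), of 1] by (intro sep_cone.kron) auto
  finally show ?case .
qed

lemma sep_cone_sum:
  assumes "finite I" "\<And>k. k \<in> I \<Longrightarrow> T k \<in> sep_cone a b"
  shows "mat (a * b) (a * b) (\<lambda>ij. \<Sum>k\<in>I. T k $$ ij) \<in> sep_cone a b"
  using assms
proof (induction I rule: finite_induct)
  case empty
  have "mat (a * b) (a * b) (\<lambda>ij. \<Sum>k\<in>{}. T k $$ ij) = 0\<^sub>m (a * b) (a * b)" by (intro eq_matI) auto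
  then show ?case by (simp only: sep_cone.zero)
next
  case (insert k I)
  have "mat (a * b) (a * b) (\<lambda>ij. \<Sum>k\<in>insert k I. T k $$ ij)
      = T k + mat (a * b) (a * b) (\<lambda>ij. \<Sum>k\<in>I. T k $$ ij)"
    using insert.hyps sep_cone_carrier[OF insert.prems[of k]] by (intro eq_matI) auto
  then show ?case using insert by (simp add: sep_cone.add)
qed

lemma sep_cone_trace:
  assumes "X \<in> sep_cone a b"
  shows "0 \<le> Re (mat_trace X)" "mat_trace X = complex_of_real (Re (mat_trace X))"
  using psd_trace[OF sep_cone_psd[OF assms]] by auto

lemma real_lincomb_eq_sum:
  assumes "\<And>k. k < m \<Longrightarrow> T k \<in> carrier_mat n n"
  shows "real_lincomb n m c T = mat n n (\<lambda>ij. \<Sum>k<m. (complex_of_real (c k) \<cdot>\<^sub>m T k) $$ ij)"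
  unfolding real_lincomb_def using assms
  by (intro eq_matI) (auto simp: carrier_matD[OF assms] intro!: sum.cong)

lemma mat_trace_sum:
  assumes "\<And>k. k \<in> I \<Longrightarrow> T k \<in> carrier_mat n n"
  shows "mat_trace (mat n n (\<lambda>ij. \<Sum>k\<in>I. T k $$ ij)) = (\<Sum>k\<in>I. mat_trace (T k))"
proof -
  have "mat_trace (mat n n (\<lambda>ij. \<Sum>k\<in>I. T k $$ ij)) = (\<Sum>i<n. \<Sum>k\<in>I. T k $$ (i, i))"
    by (subst mat_trace_carrier[of _ n]) auto
  also have "\<dots> = (\<Sum>k\<in>I. \<Sum>i<n. T k $$ (i, i))" by (rule sum.swap)
  also have "\<dots> = (\<Sum>k\<in>I. mat_trace (T k))"
    by (rule sum.cong[OF refl]) (simp add: mat_trace_carrier[OF assms])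
  finally show ?thesis .
qed

lemma SEP_imp_sep_cone:
  assumes "S \<in> SEP a b" shows "S \<in> sep_cone a b" "mat_trace S = 1"
proof -
  obtain m p \<rho> \<sigma> where S: "S = real_lincomb (a * b) m p (\<lambda>k. kron (\<rho> k) (\<sigma> k))"
    and d: "\<And>k. k < m \<Longrightarrow> 0 \<le> p k \<and> density_op a (\<rho> k) \<and> density_op b (\<sigma> k)" and p: "(\<Sum>k<m. p k) = 1"
    using assms unfolding SEP_def by blast
  have k: "kron (\<rho> k) (\<sigma> k) \<in> sep_cone a b" if "k < m" for k
    using d[OF that] by (intro sep_cone.kron) (auto simp: density_op_def)
  have S': "S = mat (a * b) (a * b) (\<lambda>ij. \<Sum>k<m. (complex_of_real (p k) \<cdot>\<^sub>m kron (\<rho> k) (\<sigma> k)) $$ ij)"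
    unfolding S by (rule real_lincomb_eq_sum) (use k sep_cone_carrier in blast)
  show "S \<in> sep_cone a b" unfolding S' by (rule sep_cone_sum) (use k d sep_cone_scale in auto)
  have t: "mat_trace (complex_of_real (p k) \<cdot>\<^sub>m kron (\<rho> k) (\<sigma> k)) = complex_of_real (p k)" if "k < m" for k
    using density_op_kron[of a "\<rho> k" b "\<sigma> k"] d[OF that] mat_trace_smult[OF sep_cone_carrier[OF k[OF that]]]
    by (simp add: density_op_def)
  have "mat_trace S = (\<Sum>k<m. mat_trace (complex_of_real (p k) \<cdot>\<^sub>m kron (\<rho> k) (\<sigma> k)))"
    unfolding S' by (rule mat_trace_sum) (use sep_cone_carrier[OF k] in auto)
  also have "\<dots> = complex_of_real (\<Sum>k<m. p k)" by (simp add: t)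
  finally show "mat_trace S = 1" by (simp add: p)
qed

lemma SEP_density_op: "S \<in> SEP a b \<Longrightarrow> density_op (a * b) S"
  using SEP_imp_sep_cone sep_cone_psd by (auto simp: density_op_def)

lemma SEP_kron:
  assumes "density_op a \<rho>" "density_op b \<sigma>" shows "kron \<rho> \<sigma> \<in> SEP a b"
proof -
  have "kron \<rho> \<sigma> \<in> carrier_mat (a * b) (a * b)"
    using density_op_kron[OF assms] by (simp add: density_op_def psd_carrier)
  then have "kron \<rho> \<sigma> = real_lincomb (a * b) 1 (\<lambda>_. 1) (\<lambda>_. kron \<rho> \<sigma>)" (is ?eq)
    by (intro eq_matI) (auto simp: real_lincomb_def)
  show ?thesis unfolding SEP_def
    by (rule CollectI, rule exI[of _ 1], rule exI[of _ "\<lambda>_. 1"],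
        rule exI[of _ "\<lambda>_. \<rho>"], rule exI[of _ "\<lambda>_. \<sigma>"])
       (use \<open>?eq\<close> assms in simp)
qed

lemma sum_lessThan_add:
  fixes f :: "nat \<Rightarrow> 'a :: comm_monoid_add"
  shows "(\<Sum>k<m + n. f k) = (\<Sum>k<m. f k) + (\<Sum>k<n. f (m + k))"
  by (induction n) (auto simp: add.assoc)

lemma SEP_convex:
  assumes "S \<in> SEP a b" "S' \<in> SEP a b" "0 \<le> t" "0 \<le> t'" "t + t' = 1"
  shows "complex_of_real t \<cdot>\<^sub>m S + complex_of_real t' \<cdot>\<^sub>m S' \<in> SEP a b"
proof -
  obtain m p \<rho> \<sigma> where S: "S = real_lincomb (a * b) m p (\<lambda>k. kron (\<rho> k) (\<sigma> k))"
    and d: "\<And>k. k < m \<Longrightarrow> 0 \<le> p k \<and> density_op a (\<rho> k) \<and> density_op b (\<sigma> k)" and p: "(\<Sum>k<m. p k) = 1"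
    using assms(1) unfolding SEP_def by blast
  obtain m' p' \<rho>' \<sigma>' where S': "S' = real_lincomb (a * b) m' p' (\<lambda>k. kron (\<rho>' k) (\<sigma>' k))"
    and d': "\<And>k. k < m' \<Longrightarrow> 0 \<le> p' k \<and> density_op a (\<rho>' k) \<and> density_op b (\<sigma>' k)" and p': "(\<Sum>k<m'. p' k) = 1"
    using assms(2) unfolding SEP_def by blast
  define q where "q k = (if k < m then t * p k else t' * p' (k - m))" for k
  define \<alpha> where "\<alpha> k = (if k < m then \<rho> k else \<rho>' (k - m))" for k
  define \<beta> where "\<beta> k = (if k < m then \<sigma> k else \<sigma>' (k - m))" for k
  have "(\<Sum>k<m + m'. q k) = t * (\<Sum>k<m. p k) + t' * (\<Sum>k<m'. p' k)"
    by (simp add: sum_lessThan_add q_def sum_distrib_left)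
  then have "(\<Sum>k<m + m'. q k) = 1" using assms p p' by simp
  moreover have "\<forall>k<m + m'. 0 \<le> q k \<and> density_op a (\<alpha> k) \<and> density_op b (\<beta> k)"
    using d d' assms by (auto simp: q_def \<alpha>_def \<beta>_def)
  moreover have "complex_of_real t \<cdot>\<^sub>m S + complex_of_real t' \<cdot>\<^sub>m S'
      = real_lincomb (a * b) (m + m') q (\<lambda>k. kron (\<alpha> k) (\<beta> k))"
    by (intro eq_matI)
       (auto simp: S S' real_lincomb_def sum_lessThan_add q_def \<alpha>_def \<beta>_def sum_distrib_left mult.assoc)
  ultimately show ?thesis unfolding SEP_def by blast
qed

section \<open>Normalising cone elements to separable states\<close>

lemma ex_density_op:
  assumes "0 < n" shows "\<exists>\<rho>. density_op n \<rho>"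
proof -
  define X :: "complex mat" where "X = mat n n (\<lambda>(i, j). if i = 0 \<and> j = 0 then 1 else 0)"
  have "gram n (\<lambda>i j. X $$ (i, j))"
    by (rule gramI[of "{0::nat}" _ _ "\<lambda>_ i. if i = 0 then 1 else 0"]) (auto simp: X_def)
  moreover have "mat_trace X = 1"
    using assms by (subst mat_trace_carrier[of _ n]) (auto simp: X_def)
  ultimately show ?thesis by (intro exI[of _ X]) (simp add: density_op_def psd_iff_gram X_def)
qed

lemma SEP_nonempty:
  assumes "0 < a" "0 < b" shows "\<exists>S. S \<in> SEP a b"
  using ex_density_op[OF assms(1)] ex_density_op[OF assms(2)] SEP_kron by blast

text \<open>A sum is the mixture of its normalised summands with weights proportional to their
  traces. Elements of trace zero vanish, and any separable state then serves as the witness.\<close>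

lemma sep_cone_normalise:
  assumes "X \<in> sep_cone a b" "0 < a" "0 < b"
  shows "\<exists>S\<in>SEP a b. X = complex_of_real (Re (mat_trace X)) \<cdot>\<^sub>m S"
  using assms(1)
proof (induction rule: sep_cone.induct)
  case zero
  obtain S where S: "S \<in> SEP a b" using SEP_nonempty assms by blast
  have "S \<in> carrier_mat (a * b) (a * b)" using SEP_imp_sep_cone(1)[OF S] sep_cone_carrier by blast
  then have "0\<^sub>m (a * b) (a * b) = complex_of_real 0 \<cdot>\<^sub>m S" by (intro eq_matI) auto
  then show ?case using S by (metis mat_trace_zero zero_complex.sel(1))
next
  case (add X Y)
  define x where "x = Re (mat_trace X)"
  define y where "y = Re (mat_trace Y)"
  obtain S S' where S: "S \<in> SEP a b" "X = complex_of_real x \<cdot>\<^sub>m S"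
    and S': "S' \<in> SEP a b" "Y = complex_of_real y \<cdot>\<^sub>m S'"
    using add.IH unfolding x_def y_def by blast
  have c: "S \<in> carrier_mat (a * b) (a * b)" "S' \<in> carrier_mat (a * b) (a * b)"
    using SEP_imp_sep_cone(1)[OF S(1)] SEP_imp_sep_cone(1)[OF S'(1)] sep_cone_carrier by blast+
  have nn: "0 \<le> x" "0 \<le> y" using sep_cone_trace(1) add.hyps by (auto simp: x_def y_def)
  have tr: "Re (mat_trace (X + Y)) = x + y"
    using mat_trace_add[OF sep_cone_carrier sep_cone_carrier, OF add.hyps] by (simp add: x_def y_def)
  show ?case
  proof (cases "x + y = 0")
    case True
    then have "x = 0" "y = 0" using nn by auto
    then have "X + Y = complex_of_real (x + y) \<cdot>\<^sub>m S" using c S S' by (intro eq_matI) auto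
    then show ?thesis using tr S(1) by auto
  next
    case False
    define T where "T = complex_of_real (x / (x + y)) \<cdot>\<^sub>m S + complex_of_real (y / (x + y)) \<cdot>\<^sub>m S'"
    have "T \<in> SEP a b" unfolding T_def
      by (rule SEP_convex[OF S(1) S'(1)]) (use nn False in \<open>auto simp: add_divide_distrib[symmetric]\<close>)
    moreover have "complex_of_real x + complex_of_real y \<noteq> 0" using False by (metis of_real_add of_real_eq_0_iff)
    then have "X + Y = complex_of_real (x + y) \<cdot>\<^sub>m T"
      using c by (intro eq_matI) (auto simp: T_def S(2) S'(2) distrib_left)
    ultimately show ?thesis using tr by auto
  qed
next
  case (kron A B)
  have A: "A \<in> carrier_mat a a" and B: "B \<in> carrier_mat b b" using kron psd_carrier by auto
  define x where "x = Re (mat_trace A)"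
  define y where "y = Re (mat_trace B)"
  have x: "mat_trace A = complex_of_real x" "0 \<le> x" and y: "mat_trace B = complex_of_real y" "0 \<le> y"
    using psd_trace[OF kron(1)] psd_trace[OF kron(2)] by (auto simp: x_def y_def)
  have tr: "mat_trace (kron A B) = complex_of_real (x * y)" using mat_trace_kron[OF A B] x y by simp
  show ?case
  proof (cases "x * y = 0")
    case True
    \<comment> \<open>A positive semidefinite factor of trace zero is itself zero, so there is
      nothing to normalise.\<close>
    then have "A = 0\<^sub>m a a \<or> B = 0\<^sub>m b b"
      using psd_trace(3)[OF kron(1)] psd_trace(3)[OF kron(2)] by (auto simp: x_def y_def)
    then have z: "kron A B = 0\<^sub>m (a * b) (a * b)"
      using A B by (intro eq_matI) (auto simp: kron_index[OF A B] div_less_mult kron_def)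
    obtain S where S: "S \<in> SEP a b" using SEP_nonempty assms by blast
    have "S \<in> carrier_mat (a * b) (a * b)" using SEP_imp_sep_cone(1)[OF S] sep_cone_carrier by blast
    then have "kron A B = complex_of_real 0 \<cdot>\<^sub>m S" unfolding z by (intro eq_matI) auto
    then show ?thesis using S tr True by (intro bexI[of _ S]) auto
  next
    case False
    then have pos: "0 < x" "0 < y" using x y by auto
    define \<rho> where "\<rho> = complex_of_real (1 / x) \<cdot>\<^sub>m A"
    define \<sigma> where "\<sigma> = complex_of_real (1 / y) \<cdot>\<^sub>m B"
    have "density_op a \<rho>" unfolding density_op_def \<rho>_def
      using psd_scale[OF kron(1), of "1 / x"] mat_trace_smult[OF A] x pos by auto
    moreover have "density_op b \<sigma>" unfolding density_op_def \<sigma>_def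
      using psd_scale[OF kron(2), of "1 / y"] mat_trace_smult[OF B] y pos by auto
    ultimately have "kron \<rho> \<sigma> \<in> SEP a b" by (rule SEP_kron)
    moreover have "kron A B = complex_of_real (x * y) \<cdot>\<^sub>m kron \<rho> \<sigma>"
      unfolding \<rho>_def \<sigma>_def kron_smult[OF A B] using pos kron_carrier[OF A B] by (intro eq_matI) auto
    ultimately show ?thesis using tr by auto
  qed
qed

text \<open>The membership test for channel outputs: they are produced as cone elements, and their
  trace is known from trace preservation.\<close>

lemma SEP_iff_sep_cone:
  assumes "0 < a" "0 < b"
  shows "S \<in> SEP a b \<longleftrightarrow> S \<in> sep_cone a b \<and> mat_trace S = 1"
proof
  assume "S \<in> sep_cone a b \<and> mat_trace S = 1"
  moreover from this obtain S' where "S' \<in> SEP a b" "S = complex_of_real (Re (mat_trace S)) \<cdot>\<^sub>m S'"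
    using sep_cone_normalise assms by blast
  moreover have "complex_of_real 1 \<cdot>\<^sub>m S' = S'" by (intro eq_matI) auto
  ultimately show "S \<in> SEP a b" by simp
qed (simp add: SEP_imp_sep_cone)

section \<open>The extent as an optimisation over the cone\<close>

text \<open>Feasible values of the extent after merging all positive and all negative terms of a
  quasi-mixture. The set is kept instead of its infimum so that constructions can be applied to one
  decomposition at a time.\<close>

definition extent_values :: "nat \<Rightarrow> nat \<Rightarrow> complex mat \<Rightarrow> real set" where
  "extent_values a b \<omega> = {Re (mat_trace P) + Re (mat_trace Q) | P Q.
     P \<in> sep_cone a b \<and> Q \<in> sep_cone a b \<and> \<omega> = P - Q}"

lemma extent_values_sum:
  assumes "finite I" and T: "\<And>k. k \<in> I \<Longrightarrow> T k \<in> sep_cone a b"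
    and \<omega>: "\<omega> = mat (a * b) (a * b) (\<lambda>ij. \<Sum>k\<in>I. complex_of_real (c k) * T k $$ ij)"
  shows "(\<Sum>k\<in>I. \<bar>c k\<bar> * Re (mat_trace (T k))) \<in> extent_values a b \<omega>"
proof -
  \<comment> \<open>\<open>U 1\<close> collects the terms with positive coefficients and
    \<open>U (- 1)\<close> those with negative ones.\<close>
  define U where "U s = mat (a * b) (a * b) (\<lambda>ij. \<Sum>k\<in>I. (complex_of_real (max (s * c k) 0) \<cdot>\<^sub>m T k) $$ ij)"
    for s :: real
  have c: "T k \<in> carrier_mat (a * b) (a * b)" if "k \<in> I" for k using T[OF that] sep_cone_carrier by blast
  have U: "U s \<in> sep_cone a b" for s
    unfolding U_def by (intro sep_cone_sum sep_cone_scale assms) auto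
  have tr: "Re (mat_trace (U s)) = (\<Sum>k\<in>I. max (s * c k) 0 * Re (mat_trace (T k)))" for s
  proof -
    have "mat_trace (U s) = (\<Sum>k\<in>I. mat_trace (complex_of_real (max (s * c k) 0) \<cdot>\<^sub>m T k))"
      unfolding U_def by (rule mat_trace_sum) (use c in auto)
    also have "\<dots> = (\<Sum>k\<in>I. complex_of_real (max (s * c k) 0) * mat_trace (T k))"
      by (intro sum.cong refl mat_trace_smult[OF c])
    finally show ?thesis by simp
  qed
  have "\<omega> = U 1 - U (- 1)"
  proof (rule eq_matI)
    fix i j assume "i < dim_row (U 1 - U (- 1))" "j < dim_col (U 1 - U (- 1))"
    then have ij: "i < a * b" "j < a * b" by (auto simp: U_def)
    then have "(U 1 - U (- 1)) $$ (i, j)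
        = (\<Sum>k\<in>I. (complex_of_real (max (c k) 0) - complex_of_real (max (- c k) 0)) * T k $$ (i, j))"
      using c by (auto simp: U_def carrier_matD[OF c] sum_subtractf[symmetric] left_diff_distrib intro!: sum.cong)
    also have "\<dots> = \<omega> $$ (i, j)" using ij unfolding \<omega>
      by (auto simp: max_def intro!: sum.cong)
    finally show "\<omega> $$ (i, j) = (U 1 - U (- 1)) $$ (i, j)" by simp
  qed (auto simp: \<omega> U_def)
  moreover have "(\<Sum>k\<in>I. \<bar>c k\<bar> * Re (mat_trace (T k))) = Re (mat_trace (U 1)) + Re (mat_trace (U (- 1)))"
  proof -
    have "\<bar>c k\<bar> * t = max (1 * c k) 0 * t + max (- 1 * c k) 0 * t" for k t
      by (cases "0 \<le> c k") auto
    then show ?thesis unfolding tr sum.distrib[symmetric] by (intro sum.cong refl)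
  qed
  ultimately show ?thesis unfolding extent_values_def using U by blast
qed

text \<open>Even the two sets coincide: a quasi-mixture collapses to a difference of cone elements,
  and normalising \<open>P\<close> and \<open>Q\<close> gives a quasi-mixture with
  \<open>m = 2\<close>.\<close>

lemma gamma_SEP_eq_Inf_extent_values:
  assumes "0 < a" "0 < b"
  shows "gamma_SEP a b \<omega> = Inf (extent_values a b \<omega>)"
proof -
  have "{\<Sum>i<m. \<bar>c i\<bar> | (m :: nat) c T. m \<ge> 1 \<and> (\<forall>i<m. T i \<in> SEP a b) \<and> \<omega> = real_lincomb (a * b) m c T}
      = extent_values a b \<omega>" (is "?L = _")
  proof (intro equalityI subsetI)
    fix x assume "x \<in> ?L"
    then obtain m c T where x: "x = (\<Sum>i<m. \<bar>c i\<bar>)" and T: "\<And>i. i < m \<Longrightarrow> T i \<in> SEP a b"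
      and \<omega>: "\<omega> = real_lincomb (a * b) m c T" by auto
    have "(\<Sum>k<m. \<bar>c k\<bar> * Re (mat_trace (T k))) \<in> extent_values a b \<omega>"
      by (rule extent_values_sum) (use T SEP_imp_sep_cone \<omega> in \<open>auto simp: real_lincomb_def\<close>)
    moreover have "(\<Sum>k<m. \<bar>c k\<bar> * Re (mat_trace (T k))) = x"
      unfolding x by (intro sum.cong refl) (simp add: SEP_imp_sep_cone(2)[OF T])
    ultimately show "x \<in> extent_values a b \<omega>" by simp
  next
    fix x assume "x \<in> extent_values a b \<omega>"
    then obtain P Q where x: "x = Re (mat_trace P) + Re (mat_trace Q)"
      and PQ: "P \<in> sep_cone a b" "Q \<in> sep_cone a b" and \<omega>: "\<omega> = P - Q"
      unfolding extent_values_def by blast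
    obtain S where S: "S \<in> SEP a b" "P = complex_of_real (Re (mat_trace P)) \<cdot>\<^sub>m S"
      using sep_cone_normalise[OF PQ(1) assms] by blast
    obtain S' where S': "S' \<in> SEP a b" "Q = complex_of_real (Re (mat_trace Q)) \<cdot>\<^sub>m S'"
      using sep_cone_normalise[OF PQ(2) assms] by blast
    have car: "S \<in> carrier_mat (a * b) (a * b)" "S' \<in> carrier_mat (a * b) (a * b)"
      using SEP_imp_sep_cone(1)[OF S(1)] SEP_imp_sep_cone(1)[OF S'(1)] sep_cone_carrier by blast+
    define c where "c i = (if i = 0 then Re (mat_trace P) else - Re (mat_trace Q))" for i :: nat
    define T where "T i = (if i = 0 then S else S')" for i :: nat
    have "x = (\<Sum>i<2. \<bar>c i\<bar>)"
      using sep_cone_trace(1)[OF PQ(1)] sep_cone_trace(1)[OF PQ(2)] by (simp add: x c_def numeral_2_eq_2)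
    moreover have "\<omega> = real_lincomb (a * b) 2 c T"
    proof -
      have "\<omega> = complex_of_real (Re (mat_trace P)) \<cdot>\<^sub>m S - complex_of_real (Re (mat_trace Q)) \<cdot>\<^sub>m S'"
        using \<omega> S(2) S'(2) by metis
      also have "\<dots> = real_lincomb (a * b) 2 c T"
        using car by (intro eq_matI) (auto simp: real_lincomb_def c_def T_def numeral_2_eq_2)
      finally show ?thesis .
    qed
    moreover have "\<forall>i<2. T i \<in> SEP a b" using S S' by (simp add: T_def)
    ultimately show "x \<in> ?L" by (intro CollectI exI[of _ "2::nat"] exI[of _ c] exI[of _ T]) auto
  qed
  then show ?thesis by (simp add: gamma_SEP_def)
qed

lemma extent_values_nonneg: "c \<in> extent_values a b \<omega> \<Longrightarrow> 0 \<le> c"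
  unfolding extent_values_def by (auto intro!: add_nonneg_nonneg sep_cone_trace(1))

text \<open>For states this is the lower bound 1, which keeps all later logarithms
  nonnegative.\<close>

lemma extent_values_ge_trace:
  assumes "c \<in> extent_values a b \<omega>" shows "Re (mat_trace \<omega>) \<le> c"
proof -
  obtain P Q where c: "c = Re (mat_trace P) + Re (mat_trace Q)"
    and PQ: "P \<in> sep_cone a b" "Q \<in> sep_cone a b" and \<omega>: "\<omega> = P - Q"
    using assms unfolding extent_values_def by blast
  have car: "P \<in> carrier_mat (a * b) (a * b)" "Q \<in> carrier_mat (a * b) (a * b)"
    using PQ sep_cone_carrier by blast+
  have "mat_trace \<omega> = mat_trace P - mat_trace Q"
    unfolding \<omega> mat_trace_carrier[OF car(1)] mat_trace_carrier[OF car(2)] mat_trace_carrier[OF minus_carrier_mat[OF car(2)]]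
    using car by (simp add: sum_subtractf)
  then show ?thesis using sep_cone_trace(1)[OF PQ(2)] by (simp add: c)
qed

lemma extent_values_bdd_below: "bdd_below (extent_values a b \<omega>)"
  using extent_values_nonneg by (meson bdd_below.I)

text \<open>The projections that express the matrix unit at \<open>(i, k)\<close> by polarisation.\<close>

definition polar_mat :: "nat \<Rightarrow> nat \<Rightarrow> nat \<Rightarrow> nat \<Rightarrow> complex mat" where
  "polar_mat d i k l = mat d d (\<lambda>(x, y).
     (of_bool (x = i) + \<i> ^ l * of_bool (x = k)) * cnj (of_bool (y = i) + \<i> ^ l * of_bool (y = k)))"

lemma polar_mat_psd: "psd d (polar_mat d i k l)"
  unfolding psd_iff_gram polar_mat_def
  by (auto intro!: gramI[of "{0::nat}" _ _ "\<lambda>_ x. of_bool (x = i) + \<i> ^ l * of_bool (x = k)"])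

text \<open>The value 4 occurs for \<open>i = k\<close> and \<open>l = 0\<close>, where the two unit
  vectors add up.\<close>

lemma polar_mat_trace: "Re (mat_trace (polar_mat d i k l)) \<le> 4"
proof -
  have "Re (mat_trace (polar_mat d i k l)) = (\<Sum>x<d. (norm (of_bool (x = i) + \<i> ^ l * of_bool (x = k)))\<^sup>2)"
    by (subst mat_trace_carrier[of _ d]) (auto simp: polar_mat_def complex_norm_square[symmetric] simp del: complex_cnj_add)
  also have "\<dots> \<le> (\<Sum>x<d. 2 * of_bool (x = i) + 2 * of_bool (x = k))"
  proof (rule sum_mono)
    fix x
    have n: "norm (\<i> ^ l) = 1" by (simp add: norm_power)
    have "norm (1 + \<i> ^ l) \<le> 2" using norm_triangle_ineq[of 1 "\<i> ^ l"] n by simp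
    then have "(norm (1 + \<i> ^ l))\<^sup>2 \<le> 2\<^sup>2" by (intro power_mono) auto
    then show "(norm (of_bool (x = i) + \<i> ^ l * of_bool (x = k)))\<^sup>2 \<le> 2 * of_bool (x = i) + 2 * (of_bool (x = k) :: real)"
      using n by (auto simp: of_bool_def norm_mult)
  qed
  also have "\<dots> = 2 * of_bool (i < d) + 2 * of_bool (k < d)"
    unfolding sum.distrib sum_distrib_left[symmetric] by (simp add: of_bool_def)
  also have "\<dots> \<le> (4::real)" by auto
  finally show ?thesis .
qed

text \<open>Orthogonality of characters: besides the diagonal terms the entries contain cross terms
  with phases \<open>\<i> ^ l\<close> and its conjugate. Four roots are used because the unwanted
  cross term acquires the phase \<open>\<i> ^ (2 * l)\<close>, which must also sum to zero.\<close>

lemma polar_mat_sum: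
  assumes "x < d" "y < d"
  shows "(\<Sum>l<4. \<i> ^ l * polar_mat d i k l $$ (x, y)) = 4 * of_bool (x = i) * of_bool (y = k)"
    and "(\<Sum>l<4. cnj (\<i> ^ l) * polar_mat d i k l $$ (x, y)) = 4 * of_bool (x = k) * of_bool (y = i)"
  using assms by (auto simp: polar_mat_def numeral_eq_Suc of_bool_def algebra_simps)

lemma sum_of_bool_pair:
  fixes h :: "nat \<Rightarrow> nat \<Rightarrow> complex"
  assumes "x < n" "y < n"
  shows "(\<Sum>p<n. \<Sum>q<n. h p q * of_bool (x = p) * of_bool (y = q)) = h x y"
proof -
  have d: "(\<Sum>q<n. u q * of_bool (z = q)) = u z" if "z < n" for z and u :: "nat \<Rightarrow> complex"
    using that by (simp add: of_bool_def if_distrib cong: if_cong)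
  show ?thesis by (simp only: d[OF assms(2)] d[OF assms(1)])
qed

text \<open>A matrix unit of the joint system is a tensor product of local matrix units; polarising
  each factor separately expresses it through product operators.\<close>

lemma hermitian_extent_value:
  assumes X: "X \<in> carrier_mat (a * b) (a * b)"
    and herm: "\<And>p q. p < a * b \<Longrightarrow> q < a * b \<Longrightarrow> X $$ (q, p) = cnj (X $$ (p, q))"
  shows "\<exists>c\<in>extent_values a b X. c \<le> 16 * (\<Sum>p<a * b. \<Sum>q<a * b. norm (X $$ (p, q)))"
proof -
  define n where "n = a * b"
  define I where "I = ({..<n} \<times> {..<n}) \<times> ({..<4::nat} \<times> {..<4::nat})"
  define F where "F p q l = polar_mat a (p div b) (q div b) l" for p q l
  define G where "G p q k = polar_mat b (p mod b) (q mod b) k" for p q k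
  define T where "T = (\<lambda>((p, q), (l, k)). kron (F p q l) (G p q k))"
  \<comment> \<open>The extent admits only real coefficients, hence the real part; 1/16 is the
    product of the two polarisation factors 1/4.\<close>
  define c where "c = (\<lambda>((p, q), (l, k)). Re (X $$ (p, q) * \<i> ^ l * \<i> ^ k) / 16)"
  have FG: "psd a (F p q l)" "psd b (G p q k)" for p q l k by (simp_all add: F_def G_def polar_mat_psd)
  note FGc = psd_carrier[OF FG(1)] psd_carrier[OF FG(2)]
  have T: "T \<kappa> \<in> sep_cone a b" for \<kappa>
    by (auto simp: T_def split_def intro!: sep_cone.kron FG)
  have X_eq: "X = mat (a * b) (a * b) (\<lambda>ij. \<Sum>\<kappa>\<in>I. complex_of_real (c \<kappa>) * T \<kappa> $$ ij)"
  proof (rule eq_matI)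
    fix x y
    assume "x < dim_row (mat (a * b) (a * b) (\<lambda>ij. \<Sum>\<kappa>\<in>I. complex_of_real (c \<kappa>) * T \<kappa> $$ ij))"
      "y < dim_col (mat (a * b) (a * b) (\<lambda>ij. \<Sum>\<kappa>\<in>I. complex_of_real (c \<kappa>) * T \<kappa> $$ ij))"
    then have xy: "x < a * b" "y < a * b" by auto
    note dm = div_less_mult[OF xy(1)] div_less_mult[OF xy(2)]
    have eqd: "u div b = v div b \<and> u mod b = v mod b \<longleftrightarrow> u = v" for u v
      by (metis div_mod_decomp)
    \<comment> \<open>With real parts taken, the phases reproduce half of the \<open>(p, q)\<close>
      contribution and half of its conjugate at \<open>(q, p)\<close>.\<close>
    have inner: "(\<Sum>l<4. \<Sum>k<4. complex_of_real (c ((p, q), (l, k))) * T ((p, q), (l, k)) $$ (x, y))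
        = (X $$ (p, q) * of_bool (x = p) * of_bool (y = q)
          + cnj (X $$ (p, q)) * of_bool (x = q) * of_bool (y = p)) / 2" (is "?lhs = _") for p q
    proof -
      define f where "f l = F p q l $$ (x div b, y div b)" for l
      define g where "g k = G p q k $$ (x mod b, y mod b)" for k
      have Txy: "T ((p, q), (l, k)) $$ (x, y) = f l * g k" for l k
        using kron_index[OF FGc xy] by (simp add: T_def f_def g_def)
      have c_eq: "complex_of_real (c ((p, q), (l, k)))
          = (X $$ (p, q) * \<i> ^ l * \<i> ^ k + cnj (X $$ (p, q)) * cnj (\<i> ^ l) * cnj (\<i> ^ k)) / 32" for l k
      proof -
        have "complex_of_real (Re z) = (z + cnj z) / 2" for z by (simp add: complex_add_cnj)
        then show ?thesis by (simp only: c_def prod.case of_real_divide complex_cnj_mult) simp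
      qed
      have "?lhs = (X $$ (p, q) * ((\<Sum>l<4. \<i> ^ l * f l) * (\<Sum>k<4. \<i> ^ k * g k))
          + cnj (X $$ (p, q)) * ((\<Sum>l<4. cnj (\<i> ^ l) * f l) * (\<Sum>k<4. cnj (\<i> ^ k) * g k))) / 32"
        unfolding Txy c_eq sum_product
        by (simp only: sum_distrib_left sum.distrib[symmetric] sum_divide_distrib,
          intro sum.cong refl, simp add: field_simps)
      also have "\<dots> = (X $$ (p, q) * of_bool (x div b = p div b \<and> x mod b = p mod b)
            * of_bool (y div b = q div b \<and> y mod b = q mod b)
          + cnj (X $$ (p, q)) * of_bool (x div b = q div b \<and> x mod b = q mod b)
            * of_bool (y div b = p div b \<and> y mod b = p mod b)) / 2"
        unfolding f_def g_def F_def G_def polar_mat_sum[OF dm(1) dm(3)] polar_mat_sum[OF dm(2) dm(4)]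
        by (simp only: of_bool_conj) (simp add: field_simps)
      finally show ?thesis unfolding eqd .
    qed
    have "(\<Sum>\<kappa>\<in>I. complex_of_real (c \<kappa>) * T \<kappa> $$ (x, y))
        = (\<Sum>p<n. \<Sum>q<n. \<Sum>l<4. \<Sum>k<4. complex_of_real (c ((p, q), (l, k))) * T ((p, q), (l, k)) $$ (x, y))"
      unfolding I_def by (simp only: sum.cartesian_product')
    also have "\<dots> = (\<Sum>p<n. \<Sum>q<n. (X $$ (p, q) * of_bool (x = p) * of_bool (y = q)
          + cnj (X $$ (p, q)) * of_bool (x = q) * of_bool (y = p)) / 2)"
      by (simp only: inner)
    also have "\<dots> = ((\<Sum>p<n. \<Sum>q<n. X $$ (p, q) * of_bool (x = p) * of_bool (y = q))
          + (\<Sum>p<n. \<Sum>q<n. cnj (X $$ (p, q)) * of_bool (y = p) * of_bool (x = q))) / 2"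
      by (simp only: sum.distrib sum_divide_distrib add_divide_distrib mult_ac)
    also have "\<dots> = (X $$ (x, y) + cnj (X $$ (y, x))) / 2"
      using sum_of_bool_pair[of x n y "\<lambda>p q. X $$ (p, q)"] sum_of_bool_pair[of y n x "\<lambda>p q. cnj (X $$ (p, q))"] xy
      by (simp only: n_def)
    \<comment> \<open>Hermiticity makes the two halves equal.\<close>
    also have "\<dots> = X $$ (x, y)" using herm[OF xy(2) xy(1)] by simp
    finally show "X $$ (x, y) = mat (a * b) (a * b) (\<lambda>ij. \<Sum>\<kappa>\<in>I. complex_of_real (c \<kappa>) * T \<kappa> $$ ij) $$ (x, y)"
      using xy by simp
  qed (use X in auto)
  have fin: "finite I" by (simp add: I_def)
  have "(\<Sum>\<kappa>\<in>I. \<bar>c \<kappa>\<bar> * Re (mat_trace (T \<kappa>))) \<in> extent_values a b X"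
    by (rule extent_values_sum[OF fin T X_eq])
  moreover have "(\<Sum>\<kappa>\<in>I. \<bar>c \<kappa>\<bar> * Re (mat_trace (T \<kappa>))) \<le> 16 * (\<Sum>p<n. \<Sum>q<n. norm (X $$ (p, q)))"
  proof -
    have "(\<Sum>\<kappa>\<in>I. \<bar>c \<kappa>\<bar> * Re (mat_trace (T \<kappa>))) \<le> (\<Sum>\<kappa>\<in>I. norm (X $$ fst \<kappa>))"
    proof (rule sum_mono)
      fix \<kappa> :: "(nat \<times> nat) \<times> (nat \<times> nat)"
      obtain p q l k where \<kappa>: "\<kappa> = ((p, q), (l, k))" by (metis surj_pair)
      have "\<bar>c \<kappa>\<bar> \<le> norm (X $$ (p, q)) / 16"
        using abs_Re_le_cmod[of "X $$ (p, q) * \<i> ^ l * \<i> ^ k"]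
        by (simp add: c_def \<kappa> norm_mult norm_power)
      moreover have "Re (mat_trace (T \<kappa>)) \<le> 16"
      proof -
        have "Re (mat_trace (T \<kappa>)) = Re (mat_trace (F p q l)) * Re (mat_trace (G p q k))"
          using psd_trace(1)[OF FG(1)[of p q l]] psd_trace(1)[OF FG(2)[of p q k]]
          by (simp add: T_def \<kappa> mat_trace_kron[OF FGc]) (metis Im_complex_of_real mult_zero_left diff_zero)
        also have "\<dots> \<le> 4 * 4"
          using psd_trace(2)[OF FG(1)[of p q l]] psd_trace(2)[OF FG(2)[of p q k]]
          by (intro mult_mono) (auto simp: F_def G_def polar_mat_trace)
        finally show ?thesis by simp
      qed
      ultimately have "\<bar>c \<kappa>\<bar> * Re (mat_trace (T \<kappa>)) \<le> (norm (X $$ (p, q)) / 16) * 16"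
        using sep_cone_trace(1)[OF T] by (intro mult_mono) auto
      then show "\<bar>c \<kappa>\<bar> * Re (mat_trace (T \<kappa>)) \<le> norm (X $$ fst \<kappa>)"
        by (simp add: \<kappa>)
    qed
    \<comment> \<open>Each of the 16 phase pairs contributes at most
      \<open>norm (X $$ (p, q))\<close>: coefficient at most a sixteenth of it, trace at most
      16.\<close>
    also have "\<dots> = 16 * (\<Sum>p<n. \<Sum>q<n. norm (X $$ (p, q)))"
      unfolding I_def sum.cartesian_product' by (simp add: sum_distrib_left)
    finally show ?thesis .
  qed
  ultimately show ?thesis unfolding n_def by blast
qed

section \<open>Tensor products of bipartite operators\<close>

text \<open>In the order A, A', B, B' an index has four mixed-radix digits; \<open>bip_left\<close>
  recombines the A and B digits into an index of the first operator, \<open>bip_right\<close> the A'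
  and B' digits into one of the second.\<close>

definition bip_left :: "nat \<Rightarrow> nat \<Rightarrow> nat \<Rightarrow> nat \<Rightarrow> nat" where
  "bip_left b a' b' r = (r div (b * b') div a') * b + r mod (b * b') div b'"

definition bip_right :: "nat \<Rightarrow> nat \<Rightarrow> nat \<Rightarrow> nat \<Rightarrow> nat" where
  "bip_right b a' b' r = (r div (b * b') mod a') * b' + r mod (b * b') mod b'"

lemma bip_tensor_carrier:
  "bip_tensor a b a' b' X Y \<in> carrier_mat ((a * a') * (b * b')) ((a * a') * (b * b'))"
  by (simp add: bip_tensor_def Let_def)

lemma bip_tensor_dim [simp]:
  "dim_row (bip_tensor a b a' b' X Y) = (a * a') * (b * b')"
  "dim_col (bip_tensor a b a' b' X Y) = (a * a') * (b * b')"
  by (simp_all add: bip_tensor_def Let_def)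

lemma bip_tensor_index:
  assumes "r < (a * a') * (b * b')" "s < (a * a') * (b * b')"
  shows "bip_tensor a b a' b' X Y $$ (r, s)
    = X $$ (bip_left b a' b' r, bip_left b a' b' s) * Y $$ (bip_right b a' b' r, bip_right b a' b' s)"
  using assms by (simp add: bip_tensor_def Let_def bip_left_def bip_right_def)

lemma bip_index_less:
  assumes "r < (a * a') * (b * b')"
  shows "bip_left b a' b' r < a * b" "bip_right b a' b' r < a' * b'"
proof -
  note 1 = div_less_mult[OF assms]
  show "bip_left b a' b' r < a * b" "bip_right b a' b' r < a' * b'"
    unfolding bip_left_def bip_right_def
    by (rule index_less_mult; rule div_less_mult[OF 1(1)] div_less_mult[OF 1(2)])+
qed

lemma div_mod_combine:
  fixes i j b :: nat
  assumes "j < b" shows "(i * b + j) div b = i" "(i * b + j) mod b = j"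
  using assms by auto

lemma mat_trace_bip_tensor:
  assumes X: "X \<in> carrier_mat (a * b) (a * b)" and Y: "Y \<in> carrier_mat (a' * b') (a' * b')"
  shows "mat_trace (bip_tensor a b a' b' X Y) = mat_trace X * mat_trace Y"
proof -
  have "mat_trace (bip_tensor a b a' b' X Y)
      = (\<Sum>i<a. \<Sum>i'<a'. \<Sum>j<b. \<Sum>j'<b'. X $$ (i * b + j, i * b + j) * Y $$ (i' * b' + j', i' * b' + j'))"
    unfolding mat_trace_carrier[OF bip_tensor_carrier] sum_divmod
  proof (intro sum.cong refl)
    fix i i' j j' assume "i \<in> {..<a}" "i' \<in> {..<a'}" "j \<in> {..<b}" "j' \<in> {..<b'}"
    then have l: "i < a" "i' < a'" "j < b" "j' < b'" by auto
    define r where "r = (i * a' + i') * (b * b') + (j * b' + j')"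
    have r: "r < (a * a') * (b * b')" unfolding r_def by (intro index_less_mult l)
    have d: "r div (b * b') = i * a' + i'" "r mod (b * b') = j * b' + j'"
      unfolding r_def using div_mod_combine[OF index_less_mult[OF l(3,4)]] by auto
    have "bip_left b a' b' r = i * b + j" "bip_right b a' b' r = i' * b' + j'"
      unfolding bip_left_def bip_right_def d div_mod_combine[OF l(2)] div_mod_combine[OF l(4)] by auto
    then show "bip_tensor a b a' b' X Y $$ ((i * a' + i') * (b * b') + (j * b' + j'),
        (i * a' + i') * (b * b') + (j * b' + j'))
      = X $$ (i * b + j, i * b + j) * Y $$ (i' * b' + j', i' * b' + j')"
      using bip_tensor_index[OF r r, of X Y] by (simp only: r_def[symmetric])
  qed
  also have "\<dots> = (\<Sum>i<a. \<Sum>i'<a'. (\<Sum>j<b. X $$ (i * b + j, i * b + j)) * (\<Sum>j'<b'. Y $$ (i' * b' + j', i' * b' + j')))"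
    by (simp only: sum_product)
  also have "\<dots> = mat_trace X * mat_trace Y"
    unfolding mat_trace_carrier[OF X] mat_trace_carrier[OF Y] sum_divmod by (simp only: sum_product)
  finally show ?thesis .
qed

lemma psd_bip_tensor:
  assumes "psd (a * b) X" "psd (a' * b') Y"
  shows "psd ((a * a') * (b * b')) (bip_tensor a b a' b' X Y)"
proof -
  have gX: "gram (a * b) (\<lambda>i j. X $$ (i, j))" and gY: "gram (a' * b') (\<lambda>i j. Y $$ (i, j))"
    using assms by (simp_all add: psd_iff_gram)
  have "gram ((a * a') * (b * b')) (\<lambda>r s. X $$ (bip_left b a' b' r, bip_left b a' b' s)
      * Y $$ (bip_right b a' b' r, bip_right b a' b' s))"
    by (rule gram_mult[OF gram_pull[OF gX bip_index_less(1)] gram_pull[OF gY bip_index_less(2)]])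
  then have "gram ((a * a') * (b * b')) (\<lambda>r s. bip_tensor a b a' b' X Y $$ (r, s))"
    by (rule gram_cong) (simp add: bip_tensor_index)
  then show ?thesis by (simp add: psd_iff_gram bip_tensor_carrier)
qed

lemma density_op_bip_tensor:
  assumes "density_op (a * b) X" "density_op (a' * b') Y"
  shows "density_op ((a * a') * (b * b')) (bip_tensor a b a' b' X Y)"
  using assms psd_bip_tensor mat_trace_bip_tensor[OF psd_carrier psd_carrier] by (simp add: density_op_def)

text \<open>The regrouping keeps products across A:B products across AA':BB'; bilinearity then
  carries separability over to all cone elements.\<close>

lemma bip_tensor_kron:
  assumes "A \<in> carrier_mat a a" "B \<in> carrier_mat b b" "A' \<in> carrier_mat a' a'" "B' \<in> carrier_mat b' b'"
  shows "bip_tensor a b a' b' (kron A B) (kron A' B') = kron (kron A A') (kron B B')"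
proof (rule eq_matI)
  note c = kron_carrier[OF kron_carrier[OF assms(1,3)] kron_carrier[OF assms(2,4)]]
  fix r s assume "r < dim_row (kron (kron A A') (kron B B'))" "s < dim_col (kron (kron A A') (kron B B'))"
  then have rs: "r < (a * a') * (b * b')" "s < (a * a') * (b * b')" using c by auto
  have l: "bip_left b a' b' t div b = t div (b * b') div a'" "bip_left b a' b' t mod b = t mod (b * b') div b'"
    "bip_right b a' b' t div b' = t div (b * b') mod a'" "bip_right b a' b' t mod b' = t mod (b * b') mod b'"
    if "t < (a * a') * (b * b')" for t
  proof -
    note 1 = div_less_mult(2)[OF that]
    show "bip_left b a' b' t div b = t div (b * b') div a'" "bip_left b a' b' t mod b = t mod (b * b') div b'"
      "bip_right b a' b' t div b' = t div (b * b') mod a'" "bip_right b a' b' t mod b' = t mod (b * b') mod b'"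
      unfolding bip_left_def bip_right_def
      using div_mod_combine[OF div_less_mult(1)[OF 1]] div_mod_combine[OF div_less_mult(2)[OF 1]] by auto
  qed
  show "bip_tensor a b a' b' (kron A B) (kron A' B') $$ (r, s) = kron (kron A A') (kron B B') $$ (r, s)"
    unfolding bip_tensor_index[OF rs] kron_index[OF kron_carrier[OF assms(1,3)] kron_carrier[OF assms(2,4)] rs]
      kron_index[OF assms(1,2) bip_index_less(1)[OF rs(1)] bip_index_less(1)[OF rs(2)]]
      kron_index[OF assms(3,4) bip_index_less(2)[OF rs(1)] bip_index_less(2)[OF rs(2)]]
      kron_index[OF assms(1,3) div_less_mult(1)[OF rs(1)] div_less_mult(1)[OF rs(2)]]
      kron_index[OF assms(2,4) div_less_mult(2)[OF rs(1)] div_less_mult(2)[OF rs(2)]]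
      l[OF rs(1)] l[OF rs(2)]
    by (simp add: mult_ac)
qed (use kron_carrier[OF kron_carrier[OF assms(1,3)] kron_carrier[OF assms(2,4)]] in auto)

lemma bip_tensor_add_left:
  assumes "X \<in> carrier_mat (a * b) (a * b)" "X' \<in> carrier_mat (a * b) (a * b)"
  shows "bip_tensor a b a' b' (X + X') Y = bip_tensor a b a' b' X Y + bip_tensor a b a' b' X' Y"
  using assms by (intro eq_matI) (auto simp: bip_tensor_index bip_index_less distrib_right)

lemma bip_tensor_add_right:
  assumes "Y \<in> carrier_mat (a' * b') (a' * b')" "Y' \<in> carrier_mat (a' * b') (a' * b')"
  shows "bip_tensor a b a' b' X (Y + Y') = bip_tensor a b a' b' X Y + bip_tensor a b a' b' X Y'"
  using assms by (intro eq_matI) (auto simp: bip_tensor_index bip_index_less distrib_left)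

lemma sep_cone_bip_tensor:
  assumes "X \<in> sep_cone a b" "Y \<in> sep_cone a' b'"
  shows "bip_tensor a b a' b' X Y \<in> sep_cone (a * a') (b * b')"
  using assms(1)
proof (induction rule: sep_cone.induct)
  case zero
  have "bip_tensor a b a' b' (0\<^sub>m (a * b) (a * b)) Y = 0\<^sub>m ((a * a') * (b * b')) ((a * a') * (b * b'))"
    by (intro eq_matI) (auto simp: bip_tensor_index bip_index_less)
  then show ?case by (simp only: sep_cone.zero)
next
  case (add X X')
  then show ?case
    by (simp only: bip_tensor_add_left[OF sep_cone_carrier sep_cone_carrier] sep_cone.add)
next
  case (kron A B)
  show ?case using assms(2)
  proof (induction rule: sep_cone.induct)
    case zero
    have "bip_tensor a b a' b' (kron A B) (0\<^sub>m (a' * b') (a' * b')) = 0\<^sub>m ((a * a') * (b * b')) ((a * a') * (b * b'))"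
      by (intro eq_matI) (auto simp: bip_tensor_index bip_index_less)
    then show ?case by (simp only: sep_cone.zero)
  next
    case (add Y Y')
    then show ?case
      by (simp only: bip_tensor_add_right[OF sep_cone_carrier sep_cone_carrier] sep_cone.add)
  next
    case (kron A' B')
    show ?case
      unfolding bip_tensor_kron[OF psd_carrier psd_carrier psd_carrier psd_carrier,
          OF \<open>psd a A\<close> \<open>psd b B\<close> kron]
      by (intro sep_cone.kron psd_kron kron \<open>psd a A\<close> \<open>psd b B\<close>)
  qed
qed

text \<open>Expand (P - Q) tensor (P' - Q'): terms of equal sign go into \<open>U\<close>, mixed
  terms into \<open>V\<close>. Traces multiply, so the total weight is the product of the
  weights.\<close>

lemma extent_values_bip_tensor:
  assumes "c \<in> extent_values a b \<omega>" "c' \<in> extent_values a' b' \<omega>'"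
  shows "c * c' \<in> extent_values (a * a') (b * b') (bip_tensor a b a' b' \<omega> \<omega>')"
proof -
  obtain P Q where c: "c = Re (mat_trace P) + Re (mat_trace Q)"
    and PQ: "P \<in> sep_cone a b" "Q \<in> sep_cone a b" and \<omega>: "\<omega> = P - Q"
    using assms(1) unfolding extent_values_def by blast
  obtain P' Q' where c': "c' = Re (mat_trace P') + Re (mat_trace Q')"
    and PQ': "P' \<in> sep_cone a' b'" "Q' \<in> sep_cone a' b'" and \<omega>': "\<omega>' = P' - Q'"
    using assms(2) unfolding extent_values_def by blast
  let ?B = "bip_tensor a b a' b'"
  note car = sep_cone_carrier[OF PQ(1)] sep_cone_carrier[OF PQ(2)]
    sep_cone_carrier[OF PQ'(1)] sep_cone_carrier[OF PQ'(2)]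
  define U where "U = ?B P P' + ?B Q Q'"
  define V where "V = ?B P Q' + ?B Q P'"
  have UV: "U \<in> sep_cone (a * a') (b * b')" "V \<in> sep_cone (a * a') (b * b')"
    unfolding U_def V_def by (intro sep_cone.add sep_cone_bip_tensor PQ PQ')+
  have "?B \<omega> \<omega>' = U - V"
    using car unfolding U_def V_def \<omega> \<omega>'
    by (intro eq_matI) (auto simp: bip_tensor_index bip_index_less left_diff_distrib right_diff_distrib)
  moreover have "Re (mat_trace U) + Re (mat_trace V) = c * c'"
  proof -
    have "mat_trace U + mat_trace V = (mat_trace P + mat_trace Q) * (mat_trace P' + mat_trace Q')"
      unfolding U_def V_def mat_trace_add[OF bip_tensor_carrier bip_tensor_carrier]
        mat_trace_bip_tensor[OF car(1) car(3)] mat_trace_bip_tensor[OF car(1) car(4)]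
        mat_trace_bip_tensor[OF car(2) car(3)] mat_trace_bip_tensor[OF car(2) car(4)]
      by (simp add: algebra_simps)
    also have "\<dots> = complex_of_real (c * c')"
      using sep_cone_trace(2)[OF PQ(1)] sep_cone_trace(2)[OF PQ(2)]
        sep_cone_trace(2)[OF PQ'(1)] sep_cone_trace(2)[OF PQ'(2)] by (simp add: c c')
    finally show ?thesis by (metis Re_complex_of_real plus_complex.sel(1))
  qed
  ultimately show ?thesis unfolding extent_values_def using UV by (metis (mono_tags, lifting) mem_Collect_eq)
qed

section \<open>Associativity and tensor powers\<close>

lemma mod_mult_div:
  fixes x m n :: nat shows "x mod (m * n) div n = x div n mod m"
proof (cases "n = 0")
  case False
  have "x mod (m * n) = n * (x div n mod m) + x mod n" using mod_mult2_eq[of x n m] by (simp add: mult.commute)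
  then show ?thesis using False by simp
qed simp

text \<open>\<open>bip_power\<close> adds factors on the left only, so splitting a power at an
  arbitrary place needs reassociation. Both groupings read the same six digits of an index.\<close>

lemma bip_tensor_assoc:
  "bip_tensor a b (a' * a'') (b' * b'') X (bip_tensor a' b' a'' b'' Y Z)
    = bip_tensor (a * a') (b * b') a'' b'' (bip_tensor a b a' b' X Y) Z" (is "?L = ?R")
proof (rule eq_matI)
  fix r s assume "r < dim_row ?R" "s < dim_col ?R"
  then have rs: "r < (a * (a' * a'')) * (b * (b' * b''))" "s < (a * (a' * a'')) * (b * (b' * b''))"
    and rs': "r < ((a * a') * a'') * ((b * b') * b'')" "s < ((a * a') * a'') * ((b * b') * b'')"
    by (auto simp: mult.assoc)
  have idx: "bip_left b (a' * a'') (b' * b'') t = bip_left b a' b' (bip_left (b * b') a'' b'' t)"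
    "bip_left b' a'' b'' (bip_right b (a' * a'') (b' * b'') t) = bip_right b a' b' (bip_left (b * b') a'' b'' t)"
    "bip_right b' a'' b'' (bip_right b (a' * a'') (b' * b'') t) = bip_right (b * b') a'' b'' t"
    if t: "t < (a * (a' * a'')) * (b * (b' * b''))" for t
  proof -
    define \<alpha> where "\<alpha> = t div (b * (b' * b''))"
    define \<beta> where "\<beta> = t mod (b * (b' * b''))"
    have \<beta>: "\<beta> < b * (b' * b'')" using div_less_mult(2)[OF t] by (simp add: \<beta>_def)
    have R: "bip_right b (a' * a'') (b' * b'') t = (\<alpha> mod (a' * a'')) * (b' * b'') + \<beta> mod (b' * b'')"
      by (simp add: bip_right_def \<alpha>_def \<beta>_def)
    have Rd: "bip_right b (a' * a'') (b' * b'') t div (b' * b'') = \<alpha> mod (a' * a'')"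
      "bip_right b (a' * a'') (b' * b'') t mod (b' * b'') = \<beta> mod (b' * b'')"
      unfolding R using div_mod_combine[OF div_less_mult(2)[OF \<beta>]] by auto
    have L: "bip_left (b * b') a'' b'' t = (\<alpha> div a'') * (b * b') + \<beta> div b''"
      by (simp add: bip_left_def \<alpha>_def \<beta>_def mult.assoc)
    have \<beta>': "\<beta> div b'' < b * b'" using div_less_mult(1)[of \<beta> "b * b'" b''] \<beta> by (simp add: mult.assoc)
    have Ld: "bip_left (b * b') a'' b'' t div (b * b') = \<alpha> div a''"
      "bip_left (b * b') a'' b'' t mod (b * b') = \<beta> div b''"
      unfolding L using div_mod_combine[OF \<beta>'] by auto
    have dd: "x div (m * n) = x div n div m" for x m n :: nat
      by (subst mult.commute) (rule div_mult2_eq)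
    show "bip_left b (a' * a'') (b' * b'') t = bip_left b a' b' (bip_left (b * b') a'' b'' t)"
      unfolding bip_left_def[of b a' b'] bip_left_def[of b "a' * a''" "b' * b''"] Ld
        \<alpha>_def[symmetric] \<beta>_def[symmetric]
      by (simp only: dd)
    show "bip_left b' a'' b'' (bip_right b (a' * a'') (b' * b'') t) = bip_right b a' b' (bip_left (b * b') a'' b'' t)"
      unfolding bip_left_def[of b' a'' b''] bip_right_def[of b a' b'] Ld Rd by (simp add: mod_mult_div)
    show "bip_right b' a'' b'' (bip_right b (a' * a'') (b' * b'') t) = bip_right (b * b') a'' b'' t"
      unfolding bip_right_def[of b' a'' b''] Rd
      by (simp add: bip_right_def \<alpha>_def \<beta>_def mult.assoc mod_mod_cancel)
  qed
  show "?L $$ (r, s) = ?R $$ (r, s)"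
    unfolding bip_tensor_index[OF rs] bip_tensor_index[OF rs']
      bip_tensor_index[OF bip_index_less(2)[OF rs(1)] bip_index_less(2)[OF rs(2)]]
      bip_tensor_index[OF bip_index_less(1)[OF rs'(1)] bip_index_less(1)[OF rs'(2)]]
      idx[OF rs(1)] idx[OF rs(2)]
    by simp
qed (auto simp: mult_ac)

lemma bip_power_density_op:
  assumes "density_op (a * b) \<rho>"
  shows "density_op (a ^ n * b ^ n) (bip_power a b \<rho> n)"
proof (induction n)
  case 0
  have "gram 1 (\<lambda>i j. (1\<^sub>m 1 :: complex mat) $$ (i, j))"
    by (rule gramI[of "{0::nat}" _ _ "\<lambda>_ _. 1"]) auto
  then show ?case by (simp add: density_op_def psd_iff_gram mat_trace_def)
next
  case (Suc n)
  show ?case using density_op_bip_tensor[OF assms Suc] by simp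
qed

lemma bip_power_add:
  assumes "density_op (a * b) \<rho>"
  shows "bip_power a b \<rho> (m + n)
    = bip_tensor (a ^ m) (b ^ m) (a ^ n) (b ^ n) (bip_power a b \<rho> m) (bip_power a b \<rho> n)"
proof (induction m)
  case 0
  define Y where "Y = bip_power a b \<rho> n"
  have Y: "Y \<in> carrier_mat (a ^ n * b ^ n) (a ^ n * b ^ n)"
    using bip_power_density_op[OF assms] by (simp add: Y_def density_op_def psd_carrier)
  \<comment> \<open>With both local dimensions of the left factor equal to 1, its index is always 0
    and the right index is \<open>r\<close> itself.\<close>
  have i: "bip_left (Suc 0) (a ^ n) (b ^ n) r = 0 \<and> bip_right (Suc 0) (a ^ n) (b ^ n) r = r"
    if "r < a ^ n * b ^ n" for r
    using div_less_mult[OF that] div_mult_mod_eq[of r "b ^ n"] by (auto simp: bip_left_def bip_right_def)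
  have "bip_tensor 1 1 (a ^ n) (b ^ n) (1\<^sub>m 1) Y = Y"
    using Y by (intro eq_matI) (auto simp: bip_tensor_index i)
  then show ?case by (simp add: Y_def)
next
  case (Suc m)
  then show ?case using bip_tensor_assoc[of a b "a ^ m" "a ^ n" "b ^ m" "b ^ n" \<rho>]
    by (simp add: power_add)
qed

section \<open>Measure-and-prepare channels\<close>

text \<open>The matrix element of \<open>X\<close> at \<psi>, that is, the unnormalised success
  probability of the rank-one test given by \<psi>.\<close>

definition expectation :: "nat \<Rightarrow> (nat \<Rightarrow> complex) \<Rightarrow> complex mat \<Rightarrow> complex" where
  "expectation d \<psi> X = (\<Sum>i<d. \<Sum>j<d. cnj (\<psi> i) * X $$ (i, j) * \<psi> j)"

text \<open>The weight of \<tau> is the trace of \<open>X\<close> against the complementary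
  projection, written as a difference so that linearity and trace preservation can be read
  off.\<close>

definition test_channel ::
    "nat \<Rightarrow> (nat \<Rightarrow> complex) \<Rightarrow> nat \<Rightarrow> complex mat \<Rightarrow> complex mat \<Rightarrow> complex mat \<Rightarrow> complex mat" where
  "test_channel d \<psi> d' \<sigma> \<tau> X = mat d' d' (\<lambda>ij.
     expectation d \<psi> X * \<sigma> $$ ij + (mat_trace X - expectation d \<psi> X) * \<tau> $$ ij)"

text \<open>Two families of vectors are allowed because off-diagonal blocks of a positive operator
  pair vectors from different blocks.\<close>

lemma expectation_gram:
  assumes "\<And>i j. i < d \<Longrightarrow> j < d \<Longrightarrow> X $$ (i, j) = (\<Sum>l<(m::nat). w l i * cnj (z l j))"
  shows "expectation d \<psi> X = (\<Sum>l<m. (\<Sum>i<d. cnj (\<psi> i) * w l i) * cnj (\<Sum>i<d. cnj (\<psi> i) * z l i))"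
proof -
  have "expectation d \<psi> X = (\<Sum>i<d. \<Sum>j<d. \<Sum>l<m. (cnj (\<psi> i) * w l i) * (\<psi> j * cnj (z l j)))"
    unfolding expectation_def
    by (intro sum.cong refl) (simp add: assms sum_distrib_left sum_distrib_right mult_ac)
  also have "\<dots> = (\<Sum>i<d. \<Sum>l<m. \<Sum>j<d. (cnj (\<psi> i) * w l i) * (\<psi> j * cnj (z l j)))"
    by (rule sum.cong[OF refl], rule sum.swap)
  also have "\<dots> = (\<Sum>l<m. \<Sum>i<d. \<Sum>j<d. (cnj (\<psi> i) * w l i) * (\<psi> j * cnj (z l j)))"
    by (rule sum.swap)
  finally show ?thesis by (simp add: sum_product)
qed

lemma expectation_psd:
  assumes "psd d X"
  shows "expectation d \<psi> X = complex_of_real (Re (expectation d \<psi> X))" "0 \<le> Re (expectation d \<psi> X)"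
proof -
  obtain m w where "\<And>i j. i < d \<Longrightarrow> j < d \<Longrightarrow> X $$ (i, j) = (\<Sum>l<(m::nat). w l i * cnj (w l j))"
    using assms unfolding psd_iff_gram by (elim conjE gramE) blast
  from expectation_gram[OF this]
  have e: "expectation d \<psi> X = complex_of_real (\<Sum>l<m. (norm (\<Sum>i<d. cnj (\<psi> i) * w l i))\<^sup>2)"
    by (simp only: of_real_sum complex_norm_square)
  show "expectation d \<psi> X = complex_of_real (Re (expectation d \<psi> X))" by (simp only: e Re_complex_of_real)
  show "0 \<le> Re (expectation d \<psi> X)" by (simp only: e Re_complex_of_real sum_nonneg zero_le_power2)
qed

lemma expectation_add:
  "X \<in> carrier_mat d d \<Longrightarrow> Y \<in> carrier_mat d d \<Longrightarrow>
    expectation d \<psi> (X + Y) = expectation d \<psi> X + expectation d \<psi> Y"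
  by (simp add: expectation_def sum.distrib distrib_left distrib_right)

lemma expectation_smult:
  "X \<in> carrier_mat d d \<Longrightarrow> expectation d \<psi> (c \<cdot>\<^sub>m X) = c * expectation d \<psi> X"
  by (simp add: expectation_def sum_distrib_left mult_ac)

text \<open>Complete positivity from explicit vectors: the Gram vectors of the input are cut into
  blocks. Their overlaps with \<psi> are Gram vectors for the success weights, and their components
  orthogonal to \<psi> are Gram vectors for the failure weights.\<close>

lemma test_channel_cptp:
  assumes \<psi>: "(\<Sum>i<d. cnj (\<psi> i) * \<psi> i) = 1"
    and \<sigma>: "density_op d' \<sigma>" and \<tau>: "density_op d' \<tau>"
  shows "cptp d d' (test_channel d \<psi> d' \<sigma> \<tau>)"
proof -
  let ?E = "test_channel d \<psi> d' \<sigma> \<tau>"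
  have car: "?E X \<in> carrier_mat d' d'" for X by (simp add: test_channel_def)
  have \<sigma>c: "\<sigma> \<in> carrier_mat d' d'" and \<tau>c: "\<tau> \<in> carrier_mat d' d'"
    using \<sigma> \<tau> by (auto simp: density_op_def psd_carrier)
  have add: "?E (X + Y) = ?E X + ?E Y" if "X \<in> carrier_mat d d" "Y \<in> carrier_mat d d" for X Y
    by (intro eq_matI)
       (auto simp: test_channel_def expectation_add[OF that] mat_trace_add[OF that] algebra_simps)
  have smult: "?E (c \<cdot>\<^sub>m X) = c \<cdot>\<^sub>m ?E X" if "X \<in> carrier_mat d d" for c X
    by (intro eq_matI)
       (auto simp: test_channel_def expectation_smult[OF that] mat_trace_smult[OF that] algebra_simps)
  have trace: "mat_trace (?E X) = mat_trace X" for X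
  proof -
    have "mat_trace (?E X) = expectation d \<psi> X * mat_trace \<sigma> + (mat_trace X - expectation d \<psi> X) * mat_trace \<tau>"
      unfolding mat_trace_carrier[OF car] mat_trace_carrier[OF \<sigma>c] mat_trace_carrier[OF \<tau>c]
      by (simp add: test_channel_def sum.distrib sum_distrib_left)
    then show ?thesis using \<sigma> \<tau> by (simp add: density_op_def)
  qed
  have cp: "psd (k * d') (ampliation k d d' ?E X)" if X: "psd (k * d) X" for k X
  proof -
    obtain m w where w: "\<And>i j. i < k * d \<Longrightarrow> j < k * d \<Longrightarrow> X $$ (i, j) = (\<Sum>l<(m::nat). w l i * cnj (w l j))"
      using X unfolding psd_iff_gram by (elim conjE gramE) blast
    define B where "B p q = mat d d (\<lambda>(i, j). X $$ (p * d + i, q * d + j))" for p q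
    define x where "x l p = (\<Sum>i<d. cnj (\<psi> i) * w l (p * d + i))" for l p
    have Bij: "B p q $$ (i, j) = (\<Sum>l<m. w l (p * d + i) * cnj (w l (q * d + j)))"
      if "p < k" "q < k" "i < d" "j < d" for p q i j
      using that by (simp add: B_def w index_less_mult)
    have eB: "expectation d \<psi> (B p q) = (\<Sum>l<m. x l p * cnj (x l q))" if "p < k" "q < k" for p q
      unfolding x_def by (rule expectation_gram) (rule Bij[OF that])
    \<comment> \<open>\<open>w l (p * d + i) - \<psi> i * x l p\<close> is the \<open>i\<close>-th
      coordinate of the block vector projected off \<psi>; normalisation of \<psi> cancels the
      surplus cross terms.\<close>
    have tB: "mat_trace (B p q) - expectation d \<psi> (B p q)
        = (\<Sum>(l, i)\<in>{..<m} \<times> {..<d}. (w l (p * d + i) - \<psi> i * x l p) * cnj (w l (q * d + i) - \<psi> i * x l q))"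
      if pq: "p < k" "q < k" for p q
    proof -
      have "mat_trace (B p q) = (\<Sum>l<m. \<Sum>i<d. w l (p * d + i) * cnj (w l (q * d + i)))"
        by (subst mat_trace_carrier[of _ d], simp add: B_def, subst sum.swap) (simp add: Bij[OF pq])
      then have "mat_trace (B p q) - expectation d \<psi> (B p q)
          = (\<Sum>l<m. (\<Sum>i<d. w l (p * d + i) * cnj (w l (q * d + i))) - x l p * cnj (x l q))"
        by (simp add: eB[OF pq] sum_subtractf)
      also have "\<dots> = (\<Sum>l<m. \<Sum>i<d. (w l (p * d + i) - \<psi> i * x l p) * cnj (w l (q * d + i) - \<psi> i * x l q))"
      proof (rule sum.cong[OF refl])
        fix l
        let ?u = "\<lambda>i. w l (p * d + i)" and ?v = "\<lambda>i. w l (q * d + i)"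
        have "(\<Sum>i<d. (?u i - \<psi> i * x l p) * cnj (?v i - \<psi> i * x l q))
            = (\<Sum>i<d. ?u i * cnj (?v i)) - cnj (x l q) * (\<Sum>i<d. cnj (\<psi> i) * ?u i)
              - x l p * (\<Sum>i<d. \<psi> i * cnj (?v i)) + x l p * cnj (x l q) * (\<Sum>i<d. cnj (\<psi> i) * \<psi> i)"
          unfolding sum_distrib_left sum_subtractf[symmetric] sum.distrib[symmetric]
          by (intro sum.cong refl) (simp add: algebra_simps)
        also have "(\<Sum>i<d. cnj (\<psi> i) * ?u i) = x l p" by (simp add: x_def)
        also have "(\<Sum>i<d. \<psi> i * cnj (?v i)) = cnj (x l q)" by (simp add: x_def)
        also note \<psi>
        finally show "(\<Sum>i<d. ?u i * cnj (?v i)) - x l p * cnj (x l q)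
            = (\<Sum>i<d. (?u i - \<psi> i * x l p) * cnj (?v i - \<psi> i * x l q))"
          by (simp only: mult.commute[of "cnj (x l q)"]) simp
      qed
      finally show ?thesis by (simp add: sum.cartesian_product)
    qed
    have gA: "gram k (\<lambda>p q. expectation d \<psi> (B p q))"
      by (rule gramI[of "{..<m}" _ _ x]) (simp_all add: eB)
    have gC: "gram k (\<lambda>p q. mat_trace (B p q) - expectation d \<psi> (B p q))"
      by (rule gramI[of "{..<m} \<times> {..<d}" _ _ "\<lambda>(l, i) p. w l (p * d + i) - \<psi> i * x l p"])
         (simp_all add: tB split_def)
    have g\<sigma>: "gram d' (\<lambda>i j. \<sigma> $$ (i, j))" and g\<tau>: "gram d' (\<lambda>i j. \<tau> $$ (i, j))"
      using \<sigma> \<tau> by (auto simp: density_op_def psd_iff_gram)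
    note dl = div_less_mult[of _ k d']
    \<comment> \<open>The output kernel is weights times \<sigma> plus weights times \<tau>, each a
      Schur product of kernels pulled back along block number and position in the block.\<close>
    have "gram (k * d') (\<lambda>r s. expectation d \<psi> (B (r div d') (s div d')) * \<sigma> $$ (r mod d', s mod d')
        + (mat_trace (B (r div d') (s div d')) - expectation d \<psi> (B (r div d') (s div d'))) * \<tau> $$ (r mod d', s mod d'))"
      by (rule gram_add[OF gram_mult[OF gram_pull[OF gA dl(1)] gram_pull[OF g\<sigma> dl(2)]]
            gram_mult[OF gram_pull[OF gC dl(1)] gram_pull[OF g\<tau> dl(2)]]])
    then have "gram (k * d') (\<lambda>r s. ampliation k d d' ?E X $$ (r, s))"
      by (rule gram_cong) (simp add: ampliation_def B_def[symmetric] test_channel_def div_less_mult)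
    then show ?thesis by (simp add: psd_iff_gram ampliation_def)
  qed
  show ?thesis unfolding cptp_def using car add smult cp trace by blast
qed

section \<open>The maximally entangled state\<close>

lemma cauchy_schwarz_complex:
  fixes f g :: "nat \<Rightarrow> complex"
  shows "(norm (\<Sum>i<n. f i * g i))\<^sup>2 \<le> (\<Sum>i<n. (norm (f i))\<^sup>2) * (\<Sum>i<n. (norm (g i))\<^sup>2)"
proof -
  have "norm (\<Sum>i<n. f i * g i) \<le> (\<Sum>i<n. norm (f i) * norm (g i))"
    by (rule order_trans[OF norm_sum]) (simp add: norm_mult)
  also have "\<dots> \<le> L2_set (\<lambda>i. norm (f i)) {..<n} * L2_set (\<lambda>i. norm (g i)) {..<n}"
    using L2_set_mult_ineq[of "\<lambda>i. norm (f i)" "\<lambda>i. norm (g i)" "{..<n}"] by simp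
  finally have "(norm (\<Sum>i<n. f i * g i))\<^sup>2 \<le> (L2_set (\<lambda>i. norm (f i)) {..<n} * L2_set (\<lambda>i. norm (g i)) {..<n})\<^sup>2"
    by (intro power_mono) auto
  then show ?thesis by (simp add: power_mult_distrib L2_set_def sum_nonneg)
qed

lemma max_ent_vec_index:
  "i < m \<Longrightarrow> j < m \<Longrightarrow> max_ent_vec m $ (i * m + j) = (if i = j then complex_of_real (1 / sqrt (real m)) else 0)"
  by (simp add: max_ent_vec_def index_less_mult)

lemma max_ent_sq:
  assumes "1 \<le> m"
  shows "complex_of_real (1 / sqrt (real m)) * complex_of_real (1 / sqrt (real m)) = 1 / of_nat m"
  using assms by (simp flip: of_real_mult) 

lemma sum_max_ent_vec:
  "(\<Sum>r<m * m. f r * max_ent_vec m $ r) = (\<Sum>i<m. f (i * m + i)) * complex_of_real (1 / sqrt (real m))"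
proof -
  have "(\<Sum>j<m. f (i * m + j) * max_ent_vec m $ (i * m + j)) = f (i * m + i) * complex_of_real (1 / sqrt (real m))"
    if i: "i < m" for i
  proof -
    have "(\<Sum>j<m. f (i * m + j) * max_ent_vec m $ (i * m + j))
        = (\<Sum>j<m. if i = j then f (i * m + j) * complex_of_real (1 / sqrt (real m)) else 0)"
      by (intro sum.cong refl) (simp add: max_ent_vec_index i)
    then show ?thesis using i by simp
  qed
  then show ?thesis unfolding sum_divmod sum_distrib_right by (intro sum.cong refl) simp
qed

lemma expectation_max_ent:
  assumes "1 \<le> m"
  shows "expectation (m * m) (\<lambda>r. max_ent_vec m $ r) X = (\<Sum>i<m. \<Sum>k<m. X $$ (i * m + i, k * m + k)) / of_nat m"
proof -
  have "expectation (m * m) (\<lambda>r. max_ent_vec m $ r) X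
      = (\<Sum>r<m * m. (\<Sum>s<m * m. X $$ (r, s) * max_ent_vec m $ s) * max_ent_vec m $ r)"
    unfolding expectation_def sum_distrib_right
    by (intro sum.cong refl) (simp add: max_ent_vec_def mult_ac)
  also have "\<dots> = (\<Sum>i<m. \<Sum>k<m. X $$ (i * m + i, k * m + k))
      * (complex_of_real (1 / sqrt (real m)) * complex_of_real (1 / sqrt (real m)))"
    unfolding sum_max_ent_vec by (simp only: sum_distrib_right mult.assoc)
  finally show ?thesis unfolding max_ent_sq[OF assms] by simp
qed

lemma max_ent_normalised:
  assumes "1 \<le> m" shows "(\<Sum>r<m * m. cnj (max_ent_vec m $ r) * max_ent_vec m $ r) = 1"
proof -
  have "(\<Sum>r<m * m. cnj (max_ent_vec m $ r) * max_ent_vec m $ r)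
      = (\<Sum>i<m. complex_of_real (1 / sqrt (real m)) * complex_of_real (1 / sqrt (real m)))"
    unfolding sum_divmod
    by (intro sum.cong refl) (simp add: max_ent_vec_index if_distrib if_distribR cong: if_cong)
  then show ?thesis using assms unfolding max_ent_sq[OF assms] by simp
qed

lemma max_ent_state_carrier: "max_ent_state m \<in> carrier_mat (m * m) (m * m)"
  by (simp add: max_ent_state_def)

lemma max_ent_state_index:
  "r < m * m \<Longrightarrow> s < m * m \<Longrightarrow> max_ent_state m $$ (r, s) = max_ent_vec m $ r * cnj (max_ent_vec m $ s)"
  by (simp add: max_ent_state_def)

lemma max_ent_state_psd: "psd (m * m) (max_ent_state m)"
  unfolding psd_iff_gram
  by (auto simp: max_ent_state_carrier max_ent_state_index intro!: gramI[of "{0::nat}" _ _ "\<lambda>_ r. max_ent_vec m $ r"])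

lemma max_ent_state_trace: "1 \<le> m \<Longrightarrow> mat_trace (max_ent_state m) = 1"
  using max_ent_normalised[of m]
  by (simp add: mat_trace_carrier[OF max_ent_state_carrier] max_ent_state_index mult.commute)

lemma expectation_max_ent_state:
  assumes "1 \<le> m" shows "expectation (m * m) (\<lambda>r. max_ent_vec m $ r) (max_ent_state m) = 1"
proof -
  have "expectation (m * m) (\<lambda>r. max_ent_vec m $ r) (max_ent_state m)
      = (\<Sum>i<m. \<Sum>k<m. complex_of_real (1 / sqrt (real m)) * complex_of_real (1 / sqrt (real m))) / of_nat m"
    unfolding expectation_max_ent[OF assms]
    by (intro arg_cong2[where f = "(/)"] sum.cong refl) (simp add: max_ent_state_index index_less_mult max_ent_vec_index)
  then show ?thesis unfolding max_ent_sq[OF assms] using assms by simp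
qed

text \<open>Both sides are additive, so products suffice. There \<open>m\<close> times the overlap
  is a sum of squared bilinear pairings of the Gram vectors of \<open>A\<close> and
  \<open>B\<close>, and Cauchy-Schwarz bounds it by the product of the traces.\<close>

lemma sep_cone_max_ent_overlap:
  assumes "X \<in> sep_cone m m" "1 \<le> m"
  shows "real m * Re (expectation (m * m) (\<lambda>r. max_ent_vec m $ r) X) \<le> Re (mat_trace X)"
  using assms(1)
proof (induction rule: sep_cone.induct)
  case zero
  then show ?case by (simp add: expectation_def)
next
  case (add X Y)
  note c = sep_cone_carrier[OF add.hyps(1)] sep_cone_carrier[OF add.hyps(2)]
  show ?case using add.IH by (simp add: expectation_add[OF c] mat_trace_add[OF c] distrib_left)
next
  case (kron A B)
  obtain k w where A: "A \<in> carrier_mat m m"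
    and w: "\<And>i j. i < m \<Longrightarrow> j < m \<Longrightarrow> A $$ (i, j) = (\<Sum>l<(k::nat). w l i * cnj (w l j))"
    using kron(1) unfolding psd_iff_gram by (elim conjE gramE) blast
  obtain k' z where B: "B \<in> carrier_mat m m"
    and z: "\<And>i j. i < m \<Longrightarrow> j < m \<Longrightarrow> B $$ (i, j) = (\<Sum>l<(k'::nat). z l i * cnj (z l j))"
    using kron(2) unfolding psd_iff_gram by (elim conjE gramE) blast
  have "(\<Sum>i<m. \<Sum>j<m. kron A B $$ (i * m + i, j * m + j))
      = (\<Sum>i<m. \<Sum>j<m. \<Sum>l<k. \<Sum>l'<k'. (w l i * z l' i) * (cnj (w l j) * cnj (z l' j)))"
    by (intro sum.cong refl)
       (simp add: kron_index[OF A B] index_less_mult w z sum_product mult_ac)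
  also have "\<dots> = (\<Sum>l<k. \<Sum>l'<k'. \<Sum>i<m. \<Sum>j<m. (w l i * z l' i) * (cnj (w l j) * cnj (z l' j)))"
  proof -
    \<comment> \<open>Grouping the four indices into two pairs reduces the exchange to a single
      swap.\<close>
    have "(\<Sum>i<m. \<Sum>j<m. \<Sum>l<k. \<Sum>l'<k'. h i j l l') = (\<Sum>l<k. \<Sum>l'<k'. \<Sum>i<m. \<Sum>j<m. h i j l l')"
      for h :: "nat \<Rightarrow> nat \<Rightarrow> nat \<Rightarrow> nat \<Rightarrow> complex"
    proof -
      have "(\<Sum>i<m. \<Sum>j<m. \<Sum>l<k. \<Sum>l'<k'. h i j l l')
          = (\<Sum>p\<in>{..<m} \<times> {..<m}. \<Sum>q\<in>{..<k} \<times> {..<k'}. h (fst p) (snd p) (fst q) (snd q))"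
        by (simp only: sum.cartesian_product' fst_conv snd_conv)
      also have "\<dots> = (\<Sum>q\<in>{..<k} \<times> {..<k'}. \<Sum>p\<in>{..<m} \<times> {..<m}. h (fst p) (snd p) (fst q) (snd q))"
        by (rule sum.swap)
      finally show ?thesis by (simp only: sum.cartesian_product' fst_conv snd_conv)
    qed
    then show ?thesis .
  qed
  also have "\<dots> = (\<Sum>l<k. \<Sum>l'<k'. (\<Sum>i<m. w l i * z l' i) * cnj (\<Sum>i<m. w l i * z l' i))"
    by (simp only: sum_product cnj_sum complex_cnj_mult)
  also have "\<dots> = complex_of_real (\<Sum>l<k. \<Sum>l'<k'. (norm (\<Sum>i<m. w l i * z l' i))\<^sup>2)"
    by (simp only: of_real_sum complex_norm_square)
  finally have "real m * Re (expectation (m * m) (\<lambda>r. max_ent_vec m $ r) (kron A B))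
      = (\<Sum>l<k. \<Sum>l'<k'. (norm (\<Sum>i<m. w l i * z l' i))\<^sup>2)"
    unfolding expectation_max_ent[OF assms(2)] using assms(2)
    by (simp del: of_real_sum of_real_power add: Re_divide_of_nat)
  also have "\<dots> \<le> (\<Sum>l<k. \<Sum>l'<k'. (\<Sum>i<m. (norm (w l i))\<^sup>2) * (\<Sum>i<m. (norm (z l' i))\<^sup>2))"
    by (intro sum_mono cauchy_schwarz_complex)
  also have "\<dots> = (\<Sum>l<k. \<Sum>i<m. (norm (w l i))\<^sup>2) * (\<Sum>l<k'. \<Sum>i<m. (norm (z l i))\<^sup>2)"
    by (simp only: sum_product)
  also have "\<dots> = Re (mat_trace (kron A B))"
  proof -
    have "mat_trace A = complex_of_real (\<Sum>l<k. \<Sum>i<m. (norm (w l i))\<^sup>2)"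
      unfolding mat_trace_carrier[OF A] of_real_sum complex_norm_square
      by (subst sum.swap) (simp add: w)
    moreover have "mat_trace B = complex_of_real (\<Sum>l<k'. \<Sum>i<m. (norm (z l i))\<^sup>2)"
      unfolding mat_trace_carrier[OF B] of_real_sum complex_norm_square
      by (subst sum.swap) (simp add: z)
    ultimately have "mat_trace (kron A B) = complex_of_real
        ((\<Sum>l<k. \<Sum>i<m. (norm (w l i))\<^sup>2) * (\<Sum>l<k'. \<Sum>i<m. (norm (z l i))\<^sup>2))"
      by (simp only: mat_trace_kron[OF A B] of_real_mult)
    then show ?thesis by (simp only: Re_complex_of_real)
  qed
  finally show ?case .
qed

text \<open>For a rank-one state the sum of the moduli of the entries is the squared 1-norm of its
  vector; here \<open>m\<close> coordinates \<open>1 / sqrt (real m)\<close> give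
  \<open>m\<close>.\<close>

lemma max_ent_extent_value:
  assumes "1 \<le> m" shows "\<exists>c\<in>extent_values m m (max_ent_state m). c \<le> 16 * real m"
proof -
  have n: "(\<Sum>r<m * m. norm (max_ent_vec m $ r)) = sqrt (real m)"
  proof -
    have "(\<Sum>r<m * m. norm (max_ent_vec m $ r)) = (\<Sum>i<m. 1 / sqrt (real m))"
      unfolding sum_divmod
      by (intro sum.cong refl) (simp add: max_ent_vec_index if_distrib norm_divide cong: if_cong)
    then show ?thesis by (simp add: real_div_sqrt)
  qed
  have "(\<Sum>p<m * m. \<Sum>q<m * m. norm (max_ent_state m $$ (p, q)))
      = (\<Sum>r<m * m. norm (max_ent_vec m $ r)) * (\<Sum>r<m * m. norm (max_ent_vec m $ r))"
    unfolding sum_product by (intro sum.cong refl) (simp add: max_ent_state_index norm_mult)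
  then have "(\<Sum>p<m * m. \<Sum>q<m * m. norm (max_ent_state m $$ (p, q))) = real m" unfolding n by simp
  moreover have "\<exists>c\<in>extent_values m m (max_ent_state m).
      c \<le> 16 * (\<Sum>p<m * m. \<Sum>q<m * m. norm (max_ent_state m $$ (p, q)))"
    by (rule hermitian_extent_value[OF max_ent_state_carrier]) (simp add: max_ent_state_index)
  ultimately show ?thesis by simp
qed

section \<open>Separability-preserving channels and the extent\<close>

lemma SEPP_sep_cone:
  assumes "E \<in> SEPP c d a b" "X \<in> sep_cone c d" "0 < c" "0 < d"
  shows "E X \<in> sep_cone a b"
proof -
  obtain S where S: "S \<in> SEP c d" "X = complex_of_real (Re (mat_trace X)) \<cdot>\<^sub>m S"
    using sep_cone_normalise[OF assms(2-4)] by blast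
  have "S \<in> carrier_mat (c * d) (c * d)" using SEP_imp_sep_cone(1)[OF S(1)] sep_cone_carrier by blast
  then have "E (k \<cdot>\<^sub>m S) = k \<cdot>\<^sub>m E S" for k
    using assms(1) by (simp add: SEPP_def cptp_def)
  then have "E X = complex_of_real (Re (mat_trace X)) \<cdot>\<^sub>m E S"
    using arg_cong[OF S(2), of E] by (simp only:)
  moreover have "E S \<in> sep_cone a b"
    using assms(1) S(1) SEP_imp_sep_cone(1) unfolding SEPP_def by blast
  ultimately show ?thesis using sep_cone_scale sep_cone_trace(1)[OF assms(2)] by metis
qed

text \<open>The image of a decomposition is a decomposition of the image, and trace preservation
  keeps its value: the channel cannot raise the extent.\<close>

lemma SEPP_extent_values:
  assumes E: "E \<in> SEPP c d a b" and "x \<in> extent_values c d X" "0 < c" "0 < d"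
  shows "x \<in> extent_values a b (E X)"
proof -
  obtain P Q where x: "x = Re (mat_trace P) + Re (mat_trace Q)"
    and PQ: "P \<in> sep_cone c d" "Q \<in> sep_cone c d" and X: "X = P - Q"
    using assms(2) unfolding extent_values_def by blast
  note car = sep_cone_carrier[OF PQ(1)] sep_cone_carrier[OF PQ(2)]
  have EPQ: "E P \<in> sep_cone a b" "E Q \<in> sep_cone a b" using SEPP_sep_cone[OF E] PQ assms by auto
  note carE = sep_cone_carrier[OF EPQ(1)] sep_cone_carrier[OF EPQ(2)]
  have lin: "E (Y + Z) = E Y + E Z" "E (k \<cdot>\<^sub>m Y) = k \<cdot>\<^sub>m E Y" "mat_trace (E Y) = mat_trace Y"
    if "Y \<in> carrier_mat (c * d) (c * d)" "Z \<in> carrier_mat (c * d) (c * d)" for Y Z k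
    using E that unfolding SEPP_def cptp_def by auto
  have "P - Q = P + (- 1) \<cdot>\<^sub>m Q" using car by (intro eq_matI) auto
  then have "E X = E P + (- 1) \<cdot>\<^sub>m E Q" unfolding X using lin(1)[OF car(1), of "(- 1) \<cdot>\<^sub>m Q"] lin(2)[OF car(2) car(2)] car by simp
  also have "\<dots> = E P - E Q" using carE by (intro eq_matI) auto
  finally have "E X = E P - E Q" .
  then show ?thesis unfolding extent_values_def x using EPQ lin(3)[OF car(1) car(1)] lin(3)[OF car(2) car(2)]
    by (metis (mono_tags, lifting) mem_Collect_eq)
qed

lemma SEPP_density_op:
  assumes E: "E \<in> SEPP c d a b" and X: "density_op (c * d) X"
  shows "density_op (a * b) (E X)"
proof -
  have cX: "X \<in> carrier_mat (c * d) (c * d)" using X by (simp add: density_op_def psd_carrier)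
  have E': "E X \<in> carrier_mat (a * b) (a * b)" "mat_trace (E X) = mat_trace X"
    using E cX unfolding SEPP_def cptp_def by auto
  \<comment> \<open>Positivity is the instance of complete positivity with a one-dimensional
    ancilla.\<close>
  have "psd (1 * (c * d)) X" using X by (simp add: density_op_def)
  then have p: "psd (1 * (a * b)) (ampliation 1 (c * d) (a * b) E X)"
    using E unfolding SEPP_def cptp_def by blast
  have "mat (c * d) (c * d) (\<lambda>(i, j). X $$ (i, j)) = X" using cX by (intro eq_matI) auto
  then have "ampliation 1 (c * d) (a * b) E X = E X"
    using E'(1) by (intro eq_matI) (auto simp: ampliation_def)
  then show ?thesis using E' X p by (simp add: density_op_def)
qed

text \<open>The channel prepares \<open>\<sigma>\<close> when the test for the maximally entangled state succeeds and \<open>\<tau>\<close> otherwise.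
  On a separable input the test succeeds with probability \<open>t \<le> 1/m\<close>, which is too small to undo the
  separability of the negative part \<open>Q\<close> of \<open>\<sigma>\<close>.\<close>

lemma ex_SEPP_max_ent:
  assumes \<sigma>: "density_op (a * b) \<sigma>" and c: "c \<in> extent_values a b \<sigma>" and m: "c \<le> real m" "1 \<le> m"
  shows "\<exists>E\<in>SEPP m m a b. E (max_ent_state m) = \<sigma>"
proof -
  have ab: "0 < a" "0 < b" using density_op_dim_pos[OF \<sigma>] by auto
  obtain P Q where c_eq: "c = Re (mat_trace P) + Re (mat_trace Q)"
    and PQ: "P \<in> sep_cone a b" "Q \<in> sep_cone a b" and \<sigma>_eq: "\<sigma> = P - Q"
    using c unfolding extent_values_def by blast
  define q where "q = Re (mat_trace Q)"
  obtain \<tau> where \<tau>: "\<tau> \<in> SEP a b" "Q = complex_of_real q \<cdot>\<^sub>m \<tau>"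
    using sep_cone_normalise[OF PQ(2) ab] unfolding q_def by blast
  note \<tau>_cone = SEP_imp_sep_cone(1)[OF \<tau>(1)]
  note car = sep_cone_carrier[OF PQ(1)] sep_cone_carrier[OF PQ(2)] sep_cone_carrier[OF \<tau>_cone]
  have "mat_trace \<sigma> = mat_trace P - mat_trace Q"
    unfolding \<sigma>_eq mat_trace_carrier[OF car(1)] mat_trace_carrier[OF car(2)] mat_trace_carrier[OF minus_carrier_mat[OF car(2)]]
    using car by (simp add: sum_subtractf)
  then have "mat_trace P - mat_trace Q = 1" using \<sigma> by (simp add: density_op_def)
  then have "Re (mat_trace P - mat_trace Q) = Re 1" by (rule arg_cong)
  then have "Re (mat_trace P) = 1 + q" by (simp add: q_def)
  \<comment> \<open>The trace of \<open>P\<close> is 1 + q and \<open>c\<close> is 1 + 2 q, so the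
    dimension bound dominates 1 + q.\<close>
  then have q: "0 \<le> q" "1 + q \<le> real m"
    using sep_cone_trace(1)[OF PQ(2)] m by (auto simp: c_eq q_def)
  define \<psi> where "\<psi> r = max_ent_vec m $ r" for r
  define E where "E = test_channel (m * m) \<psi> (a * b) \<sigma> \<tau>"
  have cptp: "cptp (m * m) (a * b) E" unfolding E_def \<psi>_def
    by (rule test_channel_cptp[OF max_ent_normalised[OF m(2)] \<sigma> SEP_density_op[OF \<tau>(1)]])
  have "E S \<in> SEP a b" if S: "S \<in> SEP m m" for S
  proof -
    note S' = SEP_imp_sep_cone[OF S]
    define t where "t = Re (expectation (m * m) \<psi> S)"
    have t: "expectation (m * m) \<psi> S = complex_of_real t" "0 \<le> t"
      using expectation_psd[OF sep_cone_psd[OF S'(1)]] by (auto simp: t_def)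
    have "real m * t \<le> 1" using sep_cone_max_ent_overlap[OF S'(1) m(2)] S'(2) by (simp add: t_def \<psi>_def[abs_def])
    moreover have "t * (1 + q) \<le> t * real m" using q t by (intro mult_left_mono) auto
    ultimately have tq: "0 \<le> 1 - t * (1 + q)" by (simp add: mult.commute)
    \<comment> \<open>In t \<sigma> + (1 - t) \<tau> the negative part of t \<sigma> is t q \<tau>,
      which is absorbed by the failure branch; the remaining weight is nonnegative because t is at
      most 1/m and 1 + q at most m.\<close>
    have "E S = complex_of_real t \<cdot>\<^sub>m P + complex_of_real (1 - t * (1 + q)) \<cdot>\<^sub>m \<tau>"
      using car by (intro eq_matI) (auto simp: E_def test_channel_def t(1) S'(2) \<sigma>_eq \<tau>(2) algebra_simps)
    also have "\<dots> \<in> sep_cone a b" using tq t by (intro sep_cone.add sep_cone_scale PQ \<tau>_cone)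
    finally have "E S \<in> sep_cone a b" .
    moreover have "mat_trace (E S) = 1"
      using cptp sep_cone_carrier[OF S'(1)] S'(2) unfolding cptp_def by simp
    ultimately show ?thesis using SEP_iff_sep_cone[OF ab] by blast
  qed
  then have "E \<in> SEPP m m a b" using cptp by (auto simp: SEPP_def)
  \<comment> \<open>On the maximally entangled state the test succeeds with certainty, so \<tau>
    receives weight 0.\<close>
  moreover have "E (max_ent_state m) = \<sigma>"
    using car expectation_max_ent_state[OF m(2)]
    by (intro eq_matI) (auto simp: E_def test_channel_def \<psi>_def[abs_def] max_ent_state_trace[OF m(2)] \<sigma>_eq)
  ultimately show ?thesis by blast
qed

section \<open>One-shot bounds\<close>

text \<open>States are Hermitian, so polarisation gives a feasible value; hence the real
  \<open>Inf\<close> is a true infimum.\<close>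

lemma density_op_extent_nonempty:
  assumes "density_op (a * b) \<sigma>" shows "extent_values a b \<sigma> \<noteq> {}"
proof -
  have X: "\<sigma> \<in> carrier_mat (a * b) (a * b)" and "gram (a * b) (\<lambda>i j. \<sigma> $$ (i, j))"
    using assms by (auto simp: density_op_def psd_iff_gram)
  then obtain m w where "\<And>i j. i < a * b \<Longrightarrow> j < a * b \<Longrightarrow> \<sigma> $$ (i, j) = (\<Sum>l<(m::nat). w l i * cnj (w l j))"
    by (elim gramE) blast
  then have "\<And>p q. p < a * b \<Longrightarrow> q < a * b \<Longrightarrow> \<sigma> $$ (q, p) = cnj (\<sigma> $$ (p, q))"
    by (simp add: mult.commute)
  then show ?thesis using hermitian_extent_value[OF X] by blast
qed

lemma gamma_SEP_le:
  assumes "density_op (a * b) \<sigma>" "c \<in> extent_values a b \<sigma>" shows "gamma_SEP a b \<sigma> \<le> c"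
proof -
  have "0 < a" "0 < b" using density_op_dim_pos[OF assms(1)] by auto
  then show ?thesis using assms(2) extent_values_bdd_below by (simp add: gamma_SEP_eq_Inf_extent_values cInf_lower)
qed

lemma gamma_SEP_greatest:
  assumes "density_op (a * b) \<sigma>" "\<And>c. c \<in> extent_values a b \<sigma> \<Longrightarrow> x \<le> c" shows "x \<le> gamma_SEP a b \<sigma>"
proof -
  have "0 < a" "0 < b" using density_op_dim_pos[OF assms(1)] by auto
  then show ?thesis using assms(2) density_op_extent_nonempty[OF assms(1)]
    by (simp add: gamma_SEP_eq_Inf_extent_values cInf_greatest)
qed

lemma extent_values_ge_1: "density_op (a * b) \<sigma> \<Longrightarrow> c \<in> extent_values a b \<sigma> \<Longrightarrow> 1 \<le> c"
  using extent_values_ge_trace[of c a b \<sigma>] by (simp add: density_op_def)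

lemma gamma_SEP_ge_1: "density_op (a * b) \<sigma> \<Longrightarrow> 1 \<le> gamma_SEP a b \<sigma>"
  by (intro gamma_SEP_greatest extent_values_ge_1)

text \<open>The infima are passed to one at a time: for a fixed value \<open>c\<close> of
  \<open>X\<close>, divide by \<open>c\<close> and minimise over \<open>Y\<close>, then divide by
  the extent of \<open>Y\<close> and minimise over \<open>X\<close>.\<close>

lemma gamma_SEP_bip_tensor:
  assumes X: "density_op (a * b) X" and Y: "density_op (a' * b') Y"
  shows "gamma_SEP (a * a') (b * b') (bip_tensor a b a' b' X Y) \<le> gamma_SEP a b X * gamma_SEP a' b' Y"
proof -
  let ?g = "gamma_SEP (a * a') (b * b') (bip_tensor a b a' b' X Y)"
  have le: "?g \<le> c * c'" if "c \<in> extent_values a b X" "c' \<in> extent_values a' b' Y" for c c'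
    by (rule gamma_SEP_le[OF density_op_bip_tensor[OF X Y] extent_values_bip_tensor[OF that]])
  have "?g / gamma_SEP a' b' Y \<le> gamma_SEP a b X"
  proof (rule gamma_SEP_greatest[OF X])
    fix c assume c: "c \<in> extent_values a b X"
    then have "0 < c" using extent_values_ge_1[OF X] by force
    have "?g / c \<le> gamma_SEP a' b' Y"
      using le[OF c] \<open>0 < c\<close> by (intro gamma_SEP_greatest[OF Y]) (simp add: field_simps)
    then show "?g / gamma_SEP a' b' Y \<le> c"
      using \<open>0 < c\<close> gamma_SEP_ge_1[OF Y] by (simp add: field_simps)
  qed
  then show ?thesis using gamma_SEP_ge_1[OF Y] by (simp add: field_simps)
qed

text \<open>The rules for \<open>Inf\<close> over the ball: \<rho> itself makes the set nonempty,
  and 1 bounds it from below.\<close>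

lemma
  assumes \<rho>: "density_op (a * b) \<rho>" and "0 \<le> \<epsilon>"
  shows gamma_SEP_eps_ge_1: "1 \<le> gamma_SEP_eps a b \<epsilon> \<rho>"
    and gamma_SEP_eps_le_gamma_SEP: "gamma_SEP_eps a b \<epsilon> \<rho> \<le> gamma_SEP a b \<rho>"
    and gamma_SEP_eps_le: "\<And>\<sigma>. density_op (a * b) \<sigma> \<Longrightarrow> trace_norm (\<rho> - \<sigma>) / 2 \<le> \<epsilon> \<Longrightarrow>
      gamma_SEP_eps a b \<epsilon> \<rho> \<le> gamma_SEP a b \<sigma>"
    and gamma_SEP_eps_greatest: "\<And>x. (\<And>\<sigma>. density_op (a * b) \<sigma> \<Longrightarrow> trace_norm (\<rho> - \<sigma>) / 2 \<le> \<epsilon> \<Longrightarrow>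
      x \<le> gamma_SEP a b \<sigma>) \<Longrightarrow> x \<le> gamma_SEP_eps a b \<epsilon> \<rho>"
proof -
  let ?S = "{gamma_SEP a b \<sigma> | \<sigma>. density_op (a * b) \<sigma> \<and> trace_norm (\<rho> - \<sigma>) / 2 \<le> \<epsilon>}"
  have c: "\<rho> \<in> carrier_mat (a * b) (a * b)" using \<rho> by (simp add: density_op_def psd_carrier)
  have "trace_norm (\<rho> - \<rho>) = 0"
    unfolding minus_r_inv_mat[OF c] by (rule trace_norm_zero[OF density_op_dim_pos[OF \<rho>]])
  then have mem: "gamma_SEP a b \<rho> \<in> ?S" using assms by auto
  have bdd: "bdd_below ?S" using gamma_SEP_ge_1 by (intro bdd_belowI[of _ 1]) auto
  show le: "\<And>\<sigma>. density_op (a * b) \<sigma> \<Longrightarrow> trace_norm (\<rho> - \<sigma>) / 2 \<le> \<epsilon> \<Longrightarrow>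
      gamma_SEP_eps a b \<epsilon> \<rho> \<le> gamma_SEP a b \<sigma>"
    unfolding gamma_SEP_eps_def by (rule cInf_lower[OF _ bdd]) blast
  show gr: "\<And>x. (\<And>\<sigma>. density_op (a * b) \<sigma> \<Longrightarrow> trace_norm (\<rho> - \<sigma>) / 2 \<le> \<epsilon> \<Longrightarrow>
      x \<le> gamma_SEP a b \<sigma>) \<Longrightarrow> x \<le> gamma_SEP_eps a b \<epsilon> \<rho>"
    unfolding gamma_SEP_eps_def by (rule cInf_greatest) (use mem in blast, fastforce)
  show "1 \<le> gamma_SEP_eps a b \<epsilon> \<rho>" by (rule gr) (rule gamma_SEP_ge_1)
  show "gamma_SEP_eps a b \<epsilon> \<rho> \<le> gamma_SEP a b \<rho>"
    unfolding gamma_SEP_eps_def by (rule cInf_lower[OF mem bdd])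
qed

lemma gamma_SEP_eps_antimono:
  assumes "density_op (a * b) \<rho>" "0 \<le> \<epsilon>" "\<epsilon> \<le> \<epsilon>'"
  shows "gamma_SEP_eps a b \<epsilon>' \<rho> \<le> gamma_SEP_eps a b \<epsilon> \<rho>"
  using assms by (intro gamma_SEP_eps_greatest gamma_SEP_eps_le) auto

text \<open>Definiteness of the trace norm shrinks the ball to \<rho>, which makes the exact
  quantities the case \<epsilon> = 0 of the smoothed ones.\<close>

lemma gamma_SEP_eps_zero:
  assumes "density_op (a * b) \<rho>" shows "gamma_SEP_eps a b 0 \<rho> = gamma_SEP a b \<rho>"
proof (rule antisym)
  show "gamma_SEP_eps a b 0 \<rho> \<le> gamma_SEP a b \<rho>" using gamma_SEP_eps_le_gamma_SEP assms by auto
  show "gamma_SEP a b \<rho> \<le> gamma_SEP_eps a b 0 \<rho>"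
  proof (rule gamma_SEP_eps_greatest[OF assms order_refl])
    fix \<sigma> assume \<sigma>: "density_op (a * b) \<sigma>" "trace_norm (\<rho> - \<sigma>) / 2 \<le> 0"
    have c: "\<rho> \<in> carrier_mat (a * b) (a * b)" "\<sigma> \<in> carrier_mat (a * b) (a * b)"
      using assms \<sigma> by (auto simp: density_op_def psd_carrier)
    have z: "\<rho> - \<sigma> = 0\<^sub>m (a * b) (a * b)"
      using \<sigma>(2) by (intro trace_norm_nonpos_imp_zero minus_carrier_mat c) simp
    have "\<rho> = \<sigma>"
    proof (rule eq_matI)
      fix i j assume "i < dim_row \<sigma>" "j < dim_col \<sigma>"
      then show "\<rho> $$ (i, j) = \<sigma> $$ (i, j)"
        using arg_cong[OF z, of "\<lambda>M. M $$ (i, j)"] c by simp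
    qed (use c in auto)
    then show "gamma_SEP a b \<rho> \<le> gamma_SEP a b \<sigma>" by simp
  qed
qed

text \<open>The gap 4 comes from the extent bound \<open>16 * real m\<close> of the maximally
  entangled state, the gap 1 from rounding a feasible value up to an integer dimension.\<close>

lemma cost_one_shot_bounds:
  assumes \<rho>: "density_op (a * b) \<rho>" and \<epsilon>: "0 \<le> \<epsilon>"
  shows "log 2 (gamma_SEP_eps a b \<epsilon> \<rho>) - 4 \<le> cost_one_shot a b \<epsilon> \<rho>"
    and "cost_one_shot a b \<epsilon> \<rho> \<le> log 2 (gamma_SEP_eps a b \<epsilon> \<rho>) + 1"
proof -
  define M where "M = {log 2 (real m) | m :: nat. m \<ge> 1 \<and>
     (\<exists>E \<in> SEPP m m a b. trace_norm (\<rho> - E (max_ent_state m)) / 2 \<le> \<epsilon>)}"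
  have cost: "cost_one_shot a b \<epsilon> \<rho> = Inf M" by (simp add: cost_one_shot_def M_def)
  have bdd: "bdd_below M" unfolding M_def by (intro bdd_belowI[of _ 0]) auto
  have up: "\<exists>x\<in>M. x \<le> log 2 c + 1"
    if \<sigma>: "density_op (a * b) \<sigma>" "trace_norm (\<rho> - \<sigma>) / 2 \<le> \<epsilon>" and c: "c \<in> extent_values a b \<sigma>" for \<sigma> c
  proof -
    have c1: "1 \<le> c" by (rule extent_values_ge_1[OF \<sigma>(1) c])
    \<comment> \<open>Since \<open>c\<close> is at least 1, the ceiling at most doubles it, which is
      one bit in the logarithm.\<close>
    define m where "m = nat \<lceil>c\<rceil>"
    have m: "c \<le> real m" "real m \<le> 2 * c" "1 \<le> m" using c1 unfolding m_def by linarith+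
    have "log 2 (real m) \<in> M" using ex_SEPP_max_ent[OF \<sigma>(1) c m(1,3)] \<sigma>(2) m(3) unfolding M_def by blast
    moreover have "log 2 (real m) \<le> log 2 (2 * c)" using m by (subst log_le_cancel_iff) auto
    then have "log 2 (real m) \<le> log 2 c + 1" using c1 by (simp add: log_mult)
    ultimately show ?thesis by blast
  qed
  \<comment> \<open>The logarithm is moved to the other side so that the bound can be checked for
    each \<sigma> and each feasible value \<open>c\<close> below the two infima.\<close>
  have "2 powr (Inf M - 1) \<le> gamma_SEP_eps a b \<epsilon> \<rho>"
  proof (rule gamma_SEP_eps_greatest[OF \<rho> \<epsilon>], rule gamma_SEP_greatest)
    fix \<sigma> c assume "density_op (a * b) \<sigma>" "trace_norm (\<rho> - \<sigma>) / 2 \<le> \<epsilon>" and c: "c \<in> extent_values a b \<sigma>"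
    then obtain x where "x \<in> M" "x \<le> log 2 c + 1" using up by blast
    then have "Inf M - 1 \<le> log 2 c" using cInf_lower[OF \<open>x \<in> M\<close> bdd] by simp
    then show "2 powr (Inf M - 1) \<le> c"
      using extent_values_ge_1[OF \<open>density_op (a * b) \<sigma>\<close> c] by (simp add: le_log_iff)
  qed
  then show "cost_one_shot a b \<epsilon> \<rho> \<le> log 2 (gamma_SEP_eps a b \<epsilon> \<rho>) + 1"
    using gamma_SEP_eps_ge_1[OF \<rho> \<epsilon>] unfolding cost by (simp add: le_log_iff[symmetric])
  have "M \<noteq> {}"
  proof -
    have c: "\<rho> \<in> carrier_mat (a * b) (a * b)" using \<rho> by (simp add: density_op_def psd_carrier)
    have "trace_norm (\<rho> - \<rho>) = 0"
      unfolding minus_r_inv_mat[OF c] by (rule trace_norm_zero[OF density_op_dim_pos[OF \<rho>]])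
    moreover obtain c where "c \<in> extent_values a b \<rho>" using density_op_extent_nonempty[OF \<rho>] by blast
    ultimately show ?thesis using up[OF \<rho>] \<epsilon> by auto
  qed
  moreover have "log 2 (gamma_SEP_eps a b \<epsilon> \<rho>) - 4 \<le> x" if "x \<in> M" for x
  proof -
    obtain m E where x: "x = log 2 (real m)" and m: "1 \<le> m" and E: "E \<in> SEPP m m a b"
      and tn: "trace_norm (\<rho> - E (max_ent_state m)) / 2 \<le> \<epsilon>"
      using \<open>x \<in> M\<close> unfolding M_def by blast
    have d: "density_op (a * b) (E (max_ent_state m))"
      by (rule SEPP_density_op[OF E]) (simp add: density_op_def max_ent_state_psd max_ent_state_trace[OF m])
    obtain c where c: "c \<in> extent_values m m (max_ent_state m)" "c \<le> 16 * real m"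
      using max_ent_extent_value[OF m] by blast
    have "gamma_SEP_eps a b \<epsilon> \<rho> \<le> gamma_SEP a b (E (max_ent_state m))"
      by (rule gamma_SEP_eps_le[OF \<rho> \<epsilon> d tn])
    also have "\<dots> \<le> c" using SEPP_extent_values[OF E c(1)] m by (intro gamma_SEP_le[OF d]) auto
    also have "\<dots> \<le> 2 powr 4 * real m" using c(2) by simp
    finally have "log 2 (gamma_SEP_eps a b \<epsilon> \<rho>) \<le> log 2 (2 powr 4 * real m)"
      using gamma_SEP_eps_ge_1[OF \<rho> \<epsilon>] m by (subst log_le_cancel_iff) auto
    also have "\<dots> = log 2 (2 powr 4) + log 2 (real m)" using m by (intro log_mult_pos) (simp_all del: powr_numeral)
    also have "log 2 (2 powr 4) = (4 :: real)" by (rule log_powr_cancel) auto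
    finally show ?thesis by (simp add: x)
  qed
  ultimately show "log 2 (gamma_SEP_eps a b \<epsilon> \<rho>) - 4 \<le> cost_one_shot a b \<epsilon> \<rho>"
    unfolding cost by (intro cInf_greatest)
qed

section \<open>Limits\<close>

text \<open>Fekete: the limit is the infimum of the quotients, reached by division with remainder by
  an index \<open>N\<close> whose quotient is nearly minimal.\<close>

lemma subadditive_convergent:
  fixes u :: "nat \<Rightarrow> real"
  assumes sub: "\<And>m n. u (m + n) \<le> u m + u n" and nonneg: "\<And>n. 0 \<le> u n"
  shows "convergent (\<lambda>n. u n / real n)"
proof -
  \<comment> \<open>Index 0 is excluded: its quotient is 0 by the convention for division by zero
    and would spoil the infimum.\<close>
  define L where "L = Inf ((\<lambda>n. u n / real n) ` {1..})"
  have bdd: "bdd_below ((\<lambda>n. u n / real n) ` {1..})"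
    using nonneg by (intro bdd_belowI[of _ 0]) auto
  have low: "L \<le> u n / real n" if "1 \<le> n" for n
    unfolding L_def using that by (intro cInf_lower[OF _ bdd]) auto
  have mult: "u (q * N + r) \<le> real q * u N + u r" for q N r
  proof (induction q)
    case (Suc q)
    have "u (Suc q * N + r) \<le> u N + u (q * N + r)" using sub[of N "q * N + r"] by (simp add: add.assoc)
    then show ?case using Suc by (simp add: algebra_simps)
  qed simp
  have "(\<lambda>n. u n / real n) \<longlonglongrightarrow> L"
  proof (rule order_tendstoI)
    fix x assume "x < L"
    then show "\<forall>\<^sub>F n in sequentially. x < u n / real n"
      using low by (intro eventually_sequentiallyI[of 1]) force
  next
    fix x assume "L < x"
    then obtain N where N: "1 \<le> N" "u N / real N < x"
      using cInf_lessD[of "(\<lambda>n. u n / real n) ` {1..}" x] unfolding L_def by auto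
    \<comment> \<open>One bound for all remainders modulo \<open>N\<close>; its contribution
      vanishes after division by \<open>n\<close>.\<close>
    define K where "K = Max (u ` {..<N})"
    have K: "u r \<le> K" if "r < N" for r unfolding K_def using that by (intro Max_ge) auto
    have lim: "(\<lambda>n. u N / real N + K / real n) \<longlonglongrightarrow> u N / real N + 0"
      by (intro tendsto_add tendsto_const lim_const_over_n)
    have "\<forall>\<^sub>F n in sequentially. u N / real N + K / real n < x"
      using order_tendstoD(2)[OF lim] N by simp
    then show "\<forall>\<^sub>F n in sequentially. u n / real n < x"
      using eventually_ge_at_top[of 1]
    proof eventually_elim
      case (elim n)
      have "u n = u (n div N * N + n mod N)" by simp
      also have "\<dots> \<le> real (n div N) * u N + u (n mod N)" by (rule mult)
      also have "\<dots> \<le> (real n / real N) * u N + K"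
        using N nonneg of_nat_div_le_of_nat[of n N, where ?'a = real] K[of "n mod N"] by (intro add_mono mult_right_mono) auto
      finally have "u n / real n \<le> ((real n / real N) * u N + K) / real n" by (simp add: divide_right_mono)
      also have "\<dots> = u N / real N + K / real n" using elim by (simp add: field_simps)
      finally show ?case using elim by simp
    qed
  qed
  then show ?thesis by (auto simp: convergent_def)
qed

section \<open>Limits inferior and the limit of vanishing error\<close>

lemma liminf_ereal_bounded:
  assumes "\<forall>\<^sub>F n in sequentially. 0 \<le> x n" "\<forall>\<^sub>F n in sequentially. x n \<le> M"
  shows "liminf (\<lambda>n. ereal (x n)) = ereal (real_of_ereal (liminf (\<lambda>n. ereal (x n))))"
    "0 \<le> real_of_ereal (liminf (\<lambda>n. ereal (x n)))" "real_of_ereal (liminf (\<lambda>n. ereal (x n))) \<le> M"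
proof -
  have "0 \<le> liminf (\<lambda>n. ereal (x n))"
    by (rule Liminf_bounded) (use assms(1) in \<open>auto elim: eventually_mono\<close>)
  moreover have "liminf (\<lambda>n. ereal (x n)) \<le> ereal M"
    by (rule Liminf_le) (use assms(2) in \<open>auto elim: eventually_mono\<close>)
  ultimately show "liminf (\<lambda>n. ereal (x n)) = ereal (real_of_ereal (liminf (\<lambda>n. ereal (x n))))"
    "0 \<le> real_of_ereal (liminf (\<lambda>n. ereal (x n)))" "real_of_ereal (liminf (\<lambda>n. ereal (x n))) \<le> M"
    by (cases "liminf (\<lambda>n. ereal (x n))"; auto)+
qed

text \<open>Exchanging the limit inferior with a map requires a monotone map that is continuous on
  all of \<open>ereal\<close>, but \<open>real_of_ereal\<close> jumps at infinity. Clipping to a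
  bounded interval repairs this and leaves the sequence eventually unchanged.\<close>

lemma liminf_ereal_powr:
  assumes "\<forall>\<^sub>F n in sequentially. 0 \<le> x n" "\<forall>\<^sub>F n in sequentially. x n \<le> M"
  shows "liminf (\<lambda>n. ereal (2 powr x n)) = ereal (2 powr real_of_ereal (liminf (\<lambda>n. ereal (x n))))"
proof -
  \<comment> \<open>The absolute value keeps the interval from 0 to \<open>\<bar>M\<bar>\<close>
    nonempty for every \<open>M\<close>.\<close>
  define clip :: "ereal \<Rightarrow> ereal" where "clip e = max 0 (min (ereal \<bar>M\<bar>) e)" for e
  define f :: "ereal \<Rightarrow> ereal" where "f e = ereal (2 powr real_of_ereal (clip e))" for e
  have clip: "0 \<le> clip e" "clip e \<le> ereal \<bar>M\<bar>" for e by (auto simp: clip_def)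
  have fin: "clip e \<noteq> \<infinity>" "clip e \<noteq> - \<infinity>" for e using clip[of e] by (cases "clip e"; simp)+
  have fx: "f (ereal t) = ereal (2 powr t)" if "0 \<le> t" "t \<le> M" for t
    using that by (simp add: f_def clip_def max_def min_def)
  have "continuous_on UNIV clip" unfolding clip_def by (intro continuous_intros)
  then have "continuous_on UNIV (\<lambda>e. real_of_ereal (clip e))"
    by (rule continuous_on_compose2[OF continuous_on_real]) (use fin in auto)
  then have "continuous_on UNIV f" unfolding f_def by (intro continuous_intros) auto
  moreover have "mono f"
  proof (rule monoI)
    fix e e' :: ereal assume "e \<le> e'"
    then have "clip e \<le> clip e'" unfolding clip_def by (intro max.mono min.mono) auto
    then have "real_of_ereal (clip e) \<le> real_of_ereal (clip e')"
      using clip fin by (intro real_of_ereal_positive_mono) auto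
    then show "f e \<le> f e'" by (simp add: f_def)
  qed
  ultimately have "liminf (\<lambda>n. f (ereal (x n))) = f (liminf (\<lambda>n. ereal (x n)))"
    by (intro Liminf_compose_continuous_mono) auto
  moreover have "liminf (\<lambda>n. f (ereal (x n))) = liminf (\<lambda>n. ereal (2 powr x n))"
    by (rule Liminf_eq) (use assms in eventually_elim, simp add: fx)
  ultimately show ?thesis using liminf_ereal_bounded[OF assms] fx by metis
qed

lemma liminf_ereal_close:
  assumes "(\<lambda>n. y n - x n) \<longlonglongrightarrow> (0 :: real)"
  shows "liminf (\<lambda>n. ereal (y n)) = liminf (\<lambda>n. ereal (x n))"
proof -
  have le: "liminf (\<lambda>n. ereal (f n)) \<le> liminf (\<lambda>n. ereal (h n))"
    if "(\<lambda>n. f n - h n) \<longlonglongrightarrow> 0" for f h :: "nat \<Rightarrow> real"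
  proof (rule ereal_le_epsilon2)
    fix e :: real assume "0 < e"
    then have "\<forall>\<^sub>F n in sequentially. f n - h n < e" using order_tendstoD(2)[OF that] by blast
    then have "liminf (\<lambda>n. ereal (f n)) \<le> liminf (\<lambda>n. ereal (h n) + ereal e)"
      by (intro Liminf_mono) (auto elim!: eventually_mono)
    also have "\<dots> = liminf (\<lambda>n. ereal (h n)) + ereal e" by (rule Liminf_add_ereal_right) auto
    finally show "liminf (\<lambda>n. ereal (f n)) \<le> liminf (\<lambda>n. ereal (h n)) + ereal e" .
  qed
  have "(\<lambda>n. x n - y n) \<longlonglongrightarrow> 0" using tendsto_minus[OF assms] by simp
  then show ?thesis using le[OF assms] le[of x y] by (intro antisym) auto
qed

text \<open>Shrinking the error raises the value, so the limit at 0 is the supremum over positive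
  errors.\<close>

lemma antimono_bounded_tendsto_at_right:
  fixes l :: "real \<Rightarrow> real"
  assumes anti: "\<And>\<epsilon> \<epsilon>'. 0 < \<epsilon> \<Longrightarrow> \<epsilon> \<le> \<epsilon>' \<Longrightarrow> l \<epsilon>' \<le> l \<epsilon>" and bound: "\<And>\<epsilon>. 0 < \<epsilon> \<Longrightarrow> l \<epsilon> \<le> M"
  shows "\<exists>L. (l \<longlongrightarrow> L) (at_right 0)"
proof -
  define L where "L = Sup (l ` {0<..})"
  have bdd: "bdd_above (l ` {0<..})" using bound by (intro bdd_aboveI[of _ M]) auto
  have "(l \<longlongrightarrow> L) (at_right 0)"
  proof (rule order_tendstoI)
    fix x assume "x < L"
    then obtain \<epsilon> where \<epsilon>: "0 < \<epsilon>" "x < l \<epsilon>"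
      using less_cSupD[of "l ` {0<..}" x] unfolding L_def by auto
    then show "\<forall>\<^sub>F e in at_right 0. x < l e"
      unfolding eventually_at_right_field using \<epsilon>(1) by (auto intro!: exI[of _ \<epsilon>] less_le_trans[OF \<epsilon>(2) anti])
  next
    fix x assume "L < x"
    moreover have "l e \<le> L" if "0 < e" for e unfolding L_def using that by (intro cSup_upper[OF _ bdd]) auto
    ultimately show "\<forall>\<^sub>F e in at_right 0. l e < x"
      unfolding eventually_at_right_field by (intro exI[of _ 1]) force
  qed
  then show ?thesis ..
qed

lemma root_eq_powr_log:
  assumes "0 < n" "0 < y" shows "root n y = 2 powr (log 2 y / real n)"
  using assms by (simp add: root_powr_inverse powr_powr[symmetric] divide_inverse)

theorem theorem5p31:
  fixes dA dB :: nat and \<rho> :: "complex mat"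
  assumes "density_op (dA * dB) \<rho>"
  shows "(log 2 (gamma_reg dA dB \<rho>) = cost_exact dA dB \<rho>)
    \<and> (log 2 (gamma_asymp dA dB \<rho>) = cost_asymp dA dB \<rho>)
    \<and> (gamma_root dA dB \<rho> \<longlonglongrightarrow> gamma_reg dA dB \<rho>)
    \<and> (cost_rate dA dB \<rho> 0 \<longlonglongrightarrow> cost_exact dA dB \<rho>)
    \<and> ((gamma_liminf dA dB \<rho> \<longlongrightarrow> ereal (gamma_asymp dA dB \<rho>)) (at_right 0))
    \<and> ((cost_liminf dA dB \<rho> \<longlongrightarrow> ereal (cost_asymp dA dB \<rho>)) (at_right 0))"
proof -
  define \<rho>n where "\<rho>n n = bip_power dA dB \<rho> n" for n
  have d: "density_op (dA ^ n * dB ^ n) (\<rho>n n)" for n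
    unfolding \<rho>n_def by (rule bip_power_density_op[OF assms])
  define g where "g \<epsilon> n = gamma_SEP_eps (dA ^ n) (dB ^ n) \<epsilon> (\<rho>n n)" for \<epsilon> n
  define u where "u n = log 2 (gamma_SEP (dA ^ n) (dB ^ n) (\<rho>n n))" for n
  \<comment> \<open>The common reference: costs differ from \<open>x\<close> by a vanishing error,
    and roots of extents are \<open>2 powr x\<close>. All limits are taken for \<open>x\<close> and
    then transported.\<close>
  define x where "x \<epsilon> n = log 2 (g \<epsilon> n) / real n" for \<epsilon> n
  note g1 = gamma_SEP_eps_ge_1[OF d, folded g_def]
  note \<gamma>1 = gamma_SEP_ge_1[OF d]
  have gpos: "0 < g \<epsilon> n" if "0 \<le> \<epsilon>" for \<epsilon> n using g1[OF that, of n] by simp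
  have \<gamma>pos: "0 < gamma_SEP (dA ^ n) (dB ^ n) (\<rho>n n)" for n using \<gamma>1[of n] by simp
  have x0: "x 0 n = u n / real n" for n
    by (simp add: x_def g_def u_def gamma_SEP_eps_zero[OF d])

  have "u (m + n) \<le> u m + u n" for m n
  proof -
    have "gamma_SEP (dA ^ (m + n)) (dB ^ (m + n)) (\<rho>n (m + n))
        \<le> gamma_SEP (dA ^ m) (dB ^ m) (\<rho>n m) * gamma_SEP (dA ^ n) (dB ^ n) (\<rho>n n)"
      using gamma_SEP_bip_tensor[OF d d, of m n] unfolding \<rho>n_def bip_power_add[OF assms] power_add .
    then have "u (m + n) \<le> log 2 (gamma_SEP (dA ^ m) (dB ^ m) (\<rho>n m) * gamma_SEP (dA ^ n) (dB ^ n) (\<rho>n n))"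
      unfolding u_def using \<gamma>1[of "m + n"] by (subst log_le_cancel_iff) (auto intro!: mult_pos_pos \<gamma>pos)
    then show ?thesis using \<gamma>1[of m] \<gamma>1[of n] by (simp add: u_def log_mult)
  qed
  moreover have "0 \<le> u n" for n using \<gamma>1[of n] by (simp add: u_def)
  ultimately obtain L where L: "x 0 \<longlonglongrightarrow> L"
    using subadditive_convergent[of u] unfolding convergent_def x0[abs_def] by blast

  \<comment> \<open>The one-shot gap is uniform in \<open>n\<close>, so the rates differ by at most
    4/n; at \<open>n = 0\<close> both sides are 0 by the division convention.\<close>
  have cost_x: "(\<lambda>n. cost_rate dA dB \<rho> \<epsilon> n - x \<epsilon> n) \<longlonglongrightarrow> 0" if "0 \<le> \<epsilon>" for \<epsilon>
  proof (rule tendsto_0_le[where K = 1])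
    show "(\<lambda>n. 4 / real n) \<longlonglongrightarrow> 0" by (rule lim_const_over_n)
    show "\<forall>\<^sub>F n in sequentially. norm (cost_rate dA dB \<rho> \<epsilon> n - x \<epsilon> n) \<le> norm (4 / real n) * 1"
    proof (rule always_eventually, rule allI)
      fix n
      have "\<bar>cost_one_shot (dA ^ n) (dB ^ n) \<epsilon> (\<rho>n n) - log 2 (g \<epsilon> n)\<bar> \<le> 4"
        using cost_one_shot_bounds[OF d that, of n] unfolding g_def by linarith
      then have "\<bar>cost_one_shot (dA ^ n) (dB ^ n) \<epsilon> (\<rho>n n) - log 2 (g \<epsilon> n)\<bar> / real n \<le> 4 / real n"
        by (rule divide_right_mono) simp
      then show "norm (cost_rate dA dB \<rho> \<epsilon> n - x \<epsilon> n) \<le> norm (4 / real n) * 1"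
        by (simp add: cost_rate_def x_def \<rho>n_def diff_divide_distrib[symmetric])
    qed
  qed
  \<comment> \<open>Only eventually: \<open>root 0\<close> is 0, whereas
    \<open>2 powr x \<epsilon> 0\<close> is 1.\<close>
  have root_x: "\<forall>\<^sub>F n in sequentially. root n (g \<epsilon> n) = 2 powr x \<epsilon> n" if "0 \<le> \<epsilon>" for \<epsilon>
    using eventually_gt_at_top[of 0]
    by eventually_elim (simp add: x_def root_eq_powr_log gpos[OF that])

  have cost0: "cost_rate dA dB \<rho> 0 \<longlonglongrightarrow> L"
    using tendsto_add[OF cost_x[OF order_refl] L] by simp
  have "(\<lambda>n. root n (g 0 n)) \<longlonglongrightarrow> 2 powr L"
    using tendsto_powr[OF tendsto_const L, of 2] root_x[OF order_refl]
    by (subst tendsto_cong) auto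
  then have root0: "gamma_root dA dB \<rho> \<longlonglongrightarrow> 2 powr L"
    unfolding gamma_root_def[abs_def] g_def gamma_SEP_eps_zero[OF d] \<rho>n_def[symmetric] .
  have exact: "cost_exact dA dB \<rho> = L" "gamma_reg dA dB \<rho> = 2 powr L"
    using limI[OF cost0] limI[OF root0] by (simp_all add: cost_exact_def gamma_reg_def)

  \<comment> \<open>A bound uniform in \<epsilon>: \<open>x 0\<close> converges and is therefore
    bounded, and it dominates every \<open>x \<epsilon>\<close>.\<close>
  obtain M where M: "x 0 n \<le> M" for n
    using convergent_imp_Bseq[of "x 0"] L unfolding convergent_def Bseq_def by (metis abs_le_D1 real_norm_def)
  have x_nonneg: "0 \<le> x \<epsilon> n" if "0 \<le> \<epsilon>" for \<epsilon> n using g1[OF that, of n] by (simp add: x_def)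
  have x_anti: "x \<epsilon>' n \<le> x \<epsilon> n" if "0 \<le> \<epsilon>" "\<epsilon> \<le> \<epsilon>'" for \<epsilon> \<epsilon>' n
  proof -
    have "g \<epsilon>' n \<le> g \<epsilon> n" unfolding g_def by (rule gamma_SEP_eps_antimono[OF d that])
    then have "log 2 (g \<epsilon>' n) \<le> log 2 (g \<epsilon> n)" using g1[of \<epsilon>' n] that by (subst log_le_cancel_iff) auto
    then show ?thesis unfolding x_def by (rule divide_right_mono) simp
  qed
  have ev: "\<forall>\<^sub>F n in sequentially. 0 \<le> x \<epsilon> n" "\<forall>\<^sub>F n in sequentially. x \<epsilon> n \<le> M" if "0 < \<epsilon>" for \<epsilon>
    using x_nonneg[of \<epsilon>] x_anti[of 0 \<epsilon>] M that by (auto intro!: always_eventually order_trans[OF x_anti[of 0 \<epsilon>]])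
  \<comment> \<open>The bounds 0 and \<open>M\<close> make these limits inferior finite, so the
    passage to \<epsilon> = 0 can be done in the reals.\<close>
  define l where "l \<epsilon> = real_of_ereal (liminf (\<lambda>n. ereal (x \<epsilon> n)))" for \<epsilon>
  note l = liminf_ereal_bounded[OF ev, folded l_def]
  have "l \<epsilon>' \<le> l \<epsilon>" if "0 < \<epsilon>" "\<epsilon> \<le> \<epsilon>'" for \<epsilon> \<epsilon>'
  proof -
    have "liminf (\<lambda>n. ereal (x \<epsilon>' n)) \<le> liminf (\<lambda>n. ereal (x \<epsilon> n))"
      using x_anti that by (intro Liminf_mono always_eventually) auto
    then show ?thesis using l(1)[of \<epsilon>] l(1)[of \<epsilon>'] that by simp
  qed
  then obtain K where K: "(l \<longlongrightarrow> K) (at_right 0)"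
    using antimono_bounded_tendsto_at_right[of l M] l(3) by blast
  have cost_l: "cost_liminf dA dB \<rho> \<epsilon> = ereal (l \<epsilon>)" if "0 < \<epsilon>" for \<epsilon>
    using liminf_ereal_close[OF cost_x[of \<epsilon>]] that l(1) by (simp add: cost_liminf_def)
  have gamma_l: "gamma_liminf dA dB \<rho> \<epsilon> = ereal (2 powr l \<epsilon>)" if "0 < \<epsilon>" for \<epsilon>
  proof -
    have "gamma_liminf dA dB \<rho> \<epsilon> = liminf (\<lambda>n. ereal (2 powr x \<epsilon> n))"
      unfolding gamma_liminf_def
      by (rule Liminf_eq) (use root_x[of \<epsilon>] that in \<open>auto simp: g_def \<rho>n_def elim: eventually_mono\<close>)
    then show ?thesis using liminf_ereal_powr[OF ev[OF that]] by (simp add: l_def)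
  qed
  \<comment> \<open>The one-sided filter sees only positive \<epsilon>, where the two functions have
    been identified with \<open>l\<close> and \<open>2 powr l\<close>.\<close>
  have pos: "\<forall>\<^sub>F \<epsilon> in at_right (0::real). 0 < \<epsilon>" by (rule eventually_at_right_less)
  have "((\<lambda>\<epsilon>. ereal (l \<epsilon>)) \<longlongrightarrow> ereal K) (at_right 0)" using K by simp
  then have cost_lim: "(cost_liminf dA dB \<rho> \<longlongrightarrow> ereal K) (at_right 0)"
    by (rule Lim_transform_eventually) (use pos in \<open>eventually_elim, simp add: cost_l\<close>)
  have "((\<lambda>\<epsilon>. ereal (2 powr l \<epsilon>)) \<longlongrightarrow> ereal (2 powr K)) (at_right 0)"
    using tendsto_powr[OF tendsto_const K, of 2] by simp
  then have gamma_lim: "(gamma_liminf dA dB \<rho> \<longlongrightarrow> ereal (2 powr K)) (at_right 0)"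
    by (rule Lim_transform_eventually) (use pos in \<open>eventually_elim, simp add: gamma_l\<close>)
  have asymp: "cost_asymp dA dB \<rho> = K" "gamma_asymp dA dB \<rho> = 2 powr K"
    using tendsto_Lim[OF _ cost_lim] tendsto_Lim[OF _ gamma_lim]
    by (simp_all add: cost_asymp_def gamma_asymp_def)
  show ?thesis unfolding exact asymp using cost0 root0 cost_lim gamma_lim by simp
qed

end
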